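(* Let $a>0$ and let $\alpha:\mathbb{R}\to[a,2]$ be Lebesgue measurable. Assume that there is $b\in(a,2)$ such that $\alpha(x)\in[a,b]$ for almost all $x\in\mathbb{R}$. Let $C$ be the continuous strictly positive function defined for all $\gamma\in[a,b]$ by $$C(\gamma)=\frac{2}{\pi}\ \text{ if }\gamma=1,\qquad C(\gamma)=\frac{1-\gamma}{\Gamma(2-\gamma)\cos(\pi\gamma/2)}\ \text{ otherwise},$$ where $\Gamma$ is the usual Gamma function. For each $f\in\mathcal{F}_\alpha$ and each real number $\lambda>0$ set $$T_f(\lambda)=\int_{\mathbb{R}}\big|\lambda^{-1}f(x)\big|^{\alpha(x)}\,C(\alpha(x))\,dx.$$ Then $$\lim_{\lambda\to+\infty}\left\{\sup_{f\in\mathcal{S}_\alpha}\left|\frac{\mathbb{P}\big(|I(f)|>\lambda\big)}{T_f(\lambda)}-1\right|\right\}=0,$$ where $\mathcal{S}_\alpha=\{f\in\mathcal{F}_\alpha:\|f\|_\alpha=1\}$ is the unit sphere of $\mathcal{F}_\alpha$.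
   Context: $\mathcal{F}_\alpha$ is the variable exponent Lebesgue space of all Lebesgue measurable real-valued functions $f$ on $\mathbb{R}$ (identified when equal almost everywhere) with $\int_{\mathbb{R}}|f(x)|^{\alpha(x)}\,dx<\infty$. For $f\in\mathcal{F}_\alpha$, $f\neq0$, the quasinorm $\|f\|_\alpha$ is the unique $\lambda_{0,f}\in(0,+\infty)$ such that $\int_{\mathbb{R}}|\lambda_{0,f}^{-1}f(x)|^{\alpha(x)}\,dx=1$; also $\|0\|_\alpha=0$. $\{I(f):f\in\mathcal{F}_\alpha\}$ denotes a real-valued stochastic process indexed by $\mathcal{F}_\alpha$ (the multistable stochastic integral, known to exist) whose finite-dimensional distributions are characterized as follows: for every integer $d\ge1$, all $f_1,\dots,f_d\in\mathcal{F}_\alpha$ and all $(\theta_1,\dots,\theta_d)\in\mathbb{R}^d$, $$\mathbb{E}\Big(\exp\Big(i\sum_{l=1}^d\theta_l I(f_l)\Big)\Big)=\exp\Big\{-\int_{\mathbb{R}}\Big|\sum_{l=1}^d\theta_l f_l(x)\Big|^{\alpha(x)}\,dx\Big\}.$$ In particular $\mathbb{E}(e^{i\theta I(f)})=\exp\{-\int_{\mathbb{R}}|\theta f(x)|^{\alpha(x)}dx\}$ for all $\theta\in\mathbb{R}$. *)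

theory Defs
  imports "HOL-Probability.Probability"
begin

text \<open>
  Elements of the space are represented by functions rather than by classes modulo equality almost
  everywhere. Exponents are positive throughout, so the convention
  \<open>0 powr s = 0\<close> agrees with the usual power.
\<close>

definition varexp_space :: "(real \<Rightarrow> real) \<Rightarrow> (real \<Rightarrow> real) set" where
  "varexp_space \<alpha> =
     {f \<in> borel_measurable lebesgue. (\<integral>\<^sup>+ x. ennreal (\<bar>f x\<bar> powr \<alpha> x) \<partial>lebesgue) < \<infinity>}"

definition varexp_norm :: "(real \<Rightarrow> real) \<Rightarrow> (real \<Rightarrow> real) \<Rightarrow> real" where
  "varexp_norm \<alpha> f =
     (if AE x in lebesgue. f x = 0 then 0
      else THE l. 0 < l \<and> (LINT x|lebesgue. \<bar>inverse l * f x\<bar> powr \<alpha> x) = 1)"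

definition varexp_sphere :: "(real \<Rightarrow> real) \<Rightarrow> (real \<Rightarrow> real) set" where
  "varexp_sphere \<alpha> = {f \<in> varexp_space \<alpha>. varexp_norm \<alpha> f = 1}"

text \<open>
  A process indexed by classes of functions is the same thing as a process indexed by functions
  that takes equal values at representatives of the same class; this is the third condition.
\<close>

definition multistable_integral ::
    "(real \<Rightarrow> real) \<Rightarrow> 'w measure \<Rightarrow> ((real \<Rightarrow> real) \<Rightarrow> 'w \<Rightarrow> real) \<Rightarrow> bool" where
  "multistable_integral \<alpha> M I \<longleftrightarrow>
     prob_space M \<and>
     (\<forall>f \<in> varexp_space \<alpha>. I f \<in> borel_measurable M) \<and>
     (\<forall>f \<in> varexp_space \<alpha>. \<forall>g \<in> varexp_space \<alpha>.
        (AE x in lebesgue. f x = g x) \<longrightarrow> (\<forall>\<omega> \<in> space M. I f \<omega> = I g \<omega>)) \<and>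
     (\<forall>(d::nat) \<ge> 1. \<forall>(f :: nat \<Rightarrow> real \<Rightarrow> real) (\<theta> :: nat \<Rightarrow> real).
        (\<forall>l \<in> {1..d}. f l \<in> varexp_space \<alpha>) \<longrightarrow>
        (CLINT \<omega>|M. exp (\<i> * complex_of_real (\<Sum>l=1..d. \<theta> l * I (f l) \<omega>))) =
          complex_of_real
            (exp (- (LINT x|lebesgue. \<bar>\<Sum>l=1..d. \<theta> l * f l x\<bar> powr \<alpha> x))))"

definition stable_tail_const :: "real \<Rightarrow> real" where
  "stable_tail_const \<gamma> =
     (if \<gamma> = 1 then 2 / pi else (1 - \<gamma>) / (Gamma (2 - \<gamma>) * cos (pi * \<gamma> / 2)))"

definition multistable_tail :: "(real \<Rightarrow> real) \<Rightarrow> (real \<Rightarrow> real) \<Rightarrow> real \<Rightarrow> real" where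
  "multistable_tail \<alpha> f t =
     (LINT x|lebesgue. \<bar>inverse t * f x\<bar> powr \<alpha> x * stable_tail_const (\<alpha> x))"

end

theory Submission imports Defs begin

text \<open>
  The multistable integral of a function on the unit sphere enters only through one probability measure.
  If \<open>\<bar>f\<bar> powr \<alpha>\<close> has integral \<open>1\<close>, let \<open>\<nu>\<close> be the law of the exponent \<open>\<alpha>\<close> under this density. Then \<open>X = I f\<close> has
  characteristic function \<open>exp (- \<psi> \<theta>)\<close>, where \<open>\<psi> \<theta>\<close> is the \<open>\<nu>\<close>-mean of \<open>\<bar>\<theta>\<bar> powr \<gamma>\<close>, and the comparison function at \<open>t\<close>
  is the \<open>\<nu>\<close>-mean of \<open>t powr - \<gamma> * stable_tail_const \<gamma>\<close>. So the task is a tail estimate for mixtures of stable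
  exponents that is uniform over all probabilities \<open>\<nu>\<close> on \<open>{a..b}\<close>.
  
  The estimate follows Karamata's method. Averaging the characteristic function over a Gaussian gives the mean of
  \<open>1 - exp (- j * (X / t)\<^sup>2)\<close> as the Gaussian mean of \<open>1 - exp (- \<psi>)\<close> at scale \<open>1 / t\<close>
  (\<open>expectation_one_minus_exp\<close>). Replacing \<open>1 - exp (- \<psi>)\<close> by \<open>\<psi>\<close> costs \<open>\<psi>\<^sup>2 / 2\<close>, which is smaller than the main
  term by a factor of order \<open>t powr - a\<close> (\<open>one_minus_exp_remainder\<close>). The main term is a Gaussian moment,
  and by a Gamma function identity it equals \<open>stable_tail_const \<gamma>\<close> times the integral of \<open>1 - exp (- j * u)\<close> against
  the power law with index \<open>\<gamma> / 2\<close>, whose tail above \<open>1\<close> has mass exactly \<open>1\<close>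
  (\<open>std_normal_abs_powr_eq_power_law\<close>).
  
  By linearity the same comparison holds for every polynomial in \<open>exp (- u)\<close> that vanishes at \<open>u = 0\<close>, with
  \<open>u = (X / t)\<^sup>2\<close>. The event \<open>\<bar>X\<bar> > t\<close> is \<open>u > 1\<close>, and the Weierstrass theorem squeezes its indicator between two such
  polynomials whose power-law integrals are within \<open>\<eta>\<close> of \<open>1\<close>, simultaneously for all exponents up to \<open>b < 2\<close>
  (\<open>poly_exp_approximates_tail\<close>). The polynomials are chosen before the mixture, which makes the threshold for
  \<open>t\<close> uniform (\<open>stable_mixture_tail_uniform\<close>).
\<close>

section \<open>The stable tail constant\<close>

lemma Gamma_reflection_real:
  fixes x :: real
  shows "Gamma x * Gamma (1 - x) = pi / sin (pi * x)"
proof -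
  have "complex_of_real (Gamma x * Gamma (1 - x)) = complex_of_real (pi / sin (pi * x))"
    using Gamma_reflection_complex[of "complex_of_real x"]
    by (simp flip: Gamma_complex_of_real sin_of_real)
  then show ?thesis
    by (simp only: of_real_eq_iff)
qed

text \<open>
  The reflection formula cancels the factor \<open>1 - \<gamma>\<close> and the cosine, so the removable singularity at
  \<open>\<gamma> = 1\<close> disappears. The formula also covers \<open>\<gamma> = 2\<close>: there \<open>Gamma 0 = 0\<close> makes the left side a
  division by zero, hence \<open>0\<close>, and the sine vanishes.
\<close>

lemma stable_tail_const_eq_Gamma_sin:
  assumes "0 < \<gamma>" "\<gamma> \<le> 2"
  shows "stable_tail_const \<gamma> = 2 * Gamma \<gamma> * sin (pi * \<gamma> / 2) / pi"
proof -
  consider "\<gamma> = 1" | "\<gamma> = 2" | "\<gamma> \<noteq> 1" "\<gamma> < 2"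
    using assms by linarith
  then show ?thesis
  proof cases
    case 3
    have dbl: "sin (pi * \<gamma>) = 2 * sin (pi * \<gamma> / 2) * cos (pi * \<gamma> / 2)"
      using sin_double[of "pi * \<gamma> / 2"] by simp
    have "1 - \<gamma> \<notin> \<int>\<^sub>\<le>\<^sub>0"
    proof
      assume "1 - \<gamma> \<in> \<int>\<^sub>\<le>\<^sub>0"
      then obtain n where "1 - \<gamma> = real_of_int n" "n \<le> 0"
        by (rule nonpos_Ints_cases)
      then have "-1 < n" "n < 0"
        using 3 by linarith+
      then show False
        by simp
    qed
    then have rec: "Gamma (2 - \<gamma>) = (1 - \<gamma>) * Gamma (1 - \<gamma>)"
      using Gamma_plus1[of "1 - \<gamma>"] by (simp add: algebra_simps)
    have refl: "Gamma \<gamma> * Gamma (1 - \<gamma>) = pi / (2 * sin (pi * \<gamma> / 2) * cos (pi * \<gamma> / 2))"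
      using Gamma_reflection_real[of \<gamma>] by (simp only: dbl)
    have s: "sin (pi * \<gamma> / 2) \<noteq> 0"
      using sin_gt_zero[of "pi * \<gamma> / 2"] 3 assms by auto
    have G: "Gamma (1 - \<gamma>) \<noteq> 0" "Gamma \<gamma> \<noteq> 0"
      using \<open>1 - \<gamma> \<notin> \<int>\<^sub>\<le>\<^sub>0\<close> Gamma_real_pos[of \<gamma>] assms by (auto simp: Gamma_eq_zero_iff)
    have c: "cos (pi * \<gamma> / 2) \<noteq> 0"
      using refl G by auto
    have "Gamma (1 - \<gamma>) * cos (pi * \<gamma> / 2) = pi / (2 * Gamma \<gamma> * sin (pi * \<gamma> / 2))"
      using refl s c G by (simp add: eq_divide_eq mult_ac)
    then have "stable_tail_const \<gamma> = 1 / (pi / (2 * Gamma \<gamma> * sin (pi * \<gamma> / 2)))"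
      using 3 by (simp add: stable_tail_const_def rec flip: mult.assoc)
    then show ?thesis
      by simp
  qed (auto simp: stable_tail_const_def)
qed

lemma Gamma_legendre_duplication_real:
  fixes x :: real
  assumes "x > 0"
  shows "Gamma (x / 2) * Gamma ((x + 1) / 2) = 2 powr (1 - x) * sqrt pi * Gamma x"
proof -
  have h: "complex_of_real (x / 2) + 1 / 2 = complex_of_real ((x + 1) / 2)"
    by (simp add: field_simps)
  have *: "complex_of_real y \<notin> \<int>\<^sub>\<le>\<^sub>0" if "y > 0" for y
    using that by (auto simp: of_real_in_nonpos_Ints_iff elim!: nonpos_Ints_cases)
  have "Gamma (complex_of_real (x / 2)) * Gamma (complex_of_real (x / 2) + 1 / 2) =
      exp ((1 - 2 * complex_of_real (x / 2)) * of_real (ln 2)) * of_real (sqrt pi)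
        * Gamma (2 * complex_of_real (x / 2))"
    using assms *[of "x / 2"] *[of "(x + 1) / 2"] unfolding h[symmetric]
    by (intro Gamma_legendre_duplication) simp_all
  also have "2 * complex_of_real (x / 2) = complex_of_real x"
    by simp
  finally have "complex_of_real (Gamma (x / 2) * Gamma ((x + 1) / 2))
      = complex_of_real (exp ((1 - x) * ln 2) * sqrt pi * Gamma x)"
    unfolding h Gamma_complex_of_real by (simp flip: exp_of_real)
  then have "Gamma (x / 2) * Gamma ((x + 1) / 2) = exp ((1 - x) * ln 2) * sqrt pi * Gamma x"
    by (simp only: of_real_eq_iff)
  then show ?thesis
    by (simp add: powr_def)
qed

text \<open>
  The left side is, up to the scale \<open>2 powr (\<gamma> / 2)\<close>, the absolute moment of order \<open>\<gamma>\<close> of a standard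
  Gaussian, and \<open>Gamma (1 - \<gamma> / 2)\<close> is the integral of \<open>1 - exp (- u)\<close> against the power law with index
  \<open>\<gamma> / 2\<close>. The stable tail constant is the ratio of the two; reflection at \<open>\<gamma> / 2\<close> and
  Legendre duplication identify it.
\<close>

lemma stable_tail_const_Gaussian:
  assumes "0 < \<gamma>" "\<gamma> < 2"
  shows "2 powr \<gamma> * Gamma ((\<gamma> + 1) / 2) / sqrt pi = stable_tail_const \<gamma> * Gamma (1 - \<gamma> / 2)"
proof -
  have s: "sin (pi * \<gamma> / 2) > 0"
    using sin_gt_zero[of "pi * \<gamma> / 2"] assms by auto
  have G: "Gamma (\<gamma> / 2) > 0" "Gamma \<gamma> > 0"
    using assms by (auto intro: Gamma_real_pos)
  have r: "Gamma (1 - \<gamma> / 2) = pi / (sin (pi * \<gamma> / 2) * Gamma (\<gamma> / 2))"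
    using Gamma_reflection_real[of "\<gamma> / 2"] G s by (simp add: field_simps)
  have d: "Gamma ((\<gamma> + 1) / 2) = 2 / 2 powr \<gamma> * sqrt pi * Gamma \<gamma> / Gamma (\<gamma> / 2)"
    using Gamma_legendre_duplication_real[of \<gamma>] G assms
    by (simp add: powr_diff eq_divide_eq less_imp_neq[symmetric] mult_ac)
  show ?thesis
    using s assms unfolding r d by (simp add: stable_tail_const_eq_Gamma_sin)
qed

lemma continuous_on_stable_tail_const:
  assumes "0 < a"
  shows "continuous_on {a..2} stable_tail_const"
proof -
  have "continuous_on {a..2} (\<lambda>\<gamma>. 2 * Gamma \<gamma> * sin (pi * \<gamma> / 2) / pi)"
    using assms by (intro continuous_intros) (auto elim!: nonpos_Ints_cases)
  then show ?thesis
    by (rule continuous_on_eq) (use assms in \<open>auto simp: stable_tail_const_eq_Gamma_sin\<close>)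
qed

text \<open>
  The reciprocal Gamma function is continuous everywhere, poles of \<open>Gamma\<close> included.
\<close>

lemma stable_tail_const_measurable [measurable]: "stable_tail_const \<in> borel_measurable borel"
proof -
  have [measurable]: "(rGamma :: real \<Rightarrow> real) \<in> borel_measurable borel"
    by (intro borel_measurable_continuous_onI continuous_on_rGamma)
  have "stable_tail_const = (\<lambda>\<gamma>. if \<gamma> = 1 then 2 / pi
      else (1 - \<gamma>) * rGamma (2 - \<gamma>) / cos (pi * \<gamma> / 2))"
  proof
    have inv: "x / (inverse r * c) = x * r / c" for x r c :: real
      by (simp add: divide_inverse)
    show "stable_tail_const \<gamma> = (if \<gamma> = 1 then 2 / pi
        else (1 - \<gamma>) * rGamma (2 - \<gamma>) / cos (pi * \<gamma> / 2))" for \<gamma>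
      by (simp add: stable_tail_const_def Gamma_def inv)
  qed
  also have "\<dots> \<in> borel_measurable borel"
    by measurable
  finally show ?thesis .
qed

lemma stable_tail_const_pos:
  assumes "0 < \<gamma>" "\<gamma> < 2"
  shows "0 < stable_tail_const \<gamma>"
  using assms sin_gt_zero[of "pi * \<gamma> / 2"] Gamma_real_pos[of \<gamma>]
  by (simp add: stable_tail_const_eq_Gamma_sin)

lemma stable_tail_const_bounds:
  assumes "0 < a" "a \<le> b" "b < 2"
  obtains c K where "0 < c" "\<And>\<gamma>. \<gamma> \<in> {a..b} \<Longrightarrow> c \<le> stable_tail_const \<gamma>"
    "\<And>\<gamma>. \<gamma> \<in> {a..b} \<Longrightarrow> stable_tail_const \<gamma> \<le> K"
proof -
  have cont: "continuous_on {a..b} stable_tail_const"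
    by (rule continuous_on_subset[OF continuous_on_stable_tail_const[OF assms(1)]]) (use assms in auto)
  obtain x where x: "x \<in> {a..b}" "\<forall>y\<in>{a..b}. stable_tail_const x \<le> stable_tail_const y"
    using continuous_attains_inf[OF _ _ cont] assms by auto
  obtain y where y: "y \<in> {a..b}" "\<forall>x\<in>{a..b}. stable_tail_const x \<le> stable_tail_const y"
    using continuous_attains_sup[OF _ _ cont] assms by auto
  show ?thesis
  proof (rule that[of "stable_tail_const x" "stable_tail_const y"])
    show "0 < stable_tail_const x"
      using x(1) assms by (intro stable_tail_const_pos) auto
  qed (use x(2) y(2) in blast)+
qed

section \<open>Power laws on the positive half-line\<close>

text \<open>
  The image under squaring of the Levy measure of a symmetric \<open>2 * \<beta>\<close>-stable law, normalised so that the
  half-line above \<open>1\<close> has mass \<open>1\<close>. It is infinite near \<open>0\<close>, so only functions that vanish at \<open>0\<close>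
  are integrated against it.
\<close>

definition power_law :: "real \<Rightarrow> real measure" where
  "power_law \<beta> = density lborel (\<lambda>u. ennreal (\<beta> * u powr (- \<beta> - 1)) * indicator {0<..} u)"

lemma sets_power_law [measurable_cong, simp]: "sets (power_law \<beta>) = sets borel"
  and space_power_law [simp]: "space (power_law \<beta>) = UNIV"
  by (simp_all add: power_law_def)

lemma nn_integral_powr_tail:
  assumes "0 < \<beta>" "0 < v"
  shows "(\<integral>\<^sup>+ u. ennreal (\<beta> * u powr (- \<beta> - 1)) * indicator {v..} u \<partial>lborel) = ennreal (v powr - \<beta>)"
proof -
  have "((\<lambda>u. - (u powr - \<beta>)) \<longlongrightarrow> - 0) at_top"
    by (intro tendsto_minus tendsto_neg_powr filterlim_ident) (use assms in auto)
  then have "(\<integral>\<^sup>+ u. ennreal (\<beta> * u powr (- \<beta> - 1)) * indicator {v..} u \<partial>lborel)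
      = ennreal (- 0 - - (v powr - \<beta>))"
    by (intro nn_integral_FTC_atLeast)
      (use assms in \<open>auto intro!: derivative_eq_intros\<close>)
  then show ?thesis
    by simp
qed

lemma emeasure_power_law_tail:
  assumes "0 < \<beta>" "0 < r"
  shows "emeasure (power_law \<beta>) {r<..} = ennreal (r powr - \<beta>)"
proof -
  have "emeasure (power_law \<beta>) {r<..} =
      (\<integral>\<^sup>+ u. ennreal (\<beta> * u powr (- \<beta> - 1)) * indicator {0<..} u * indicator {r<..} u \<partial>lborel)"
    unfolding power_law_def by (subst emeasure_density) auto
  also have "\<dots> = (\<integral>\<^sup>+ u. ennreal (\<beta> * u powr (- \<beta> - 1)) * indicator {r..} u \<partial>lborel)"
    by (rule nn_integral_cong_AE, rule AE_mp[OF AE_lborel_singleton[of r]])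
      (use assms in \<open>auto split: split_indicator\<close>)
  finally show ?thesis
    using nn_integral_powr_tail[OF assms] by simp
qed

lemma nn_integral_exp_powr:
  assumes "\<beta> < 1" "0 < j"
  shows "(\<integral>\<^sup>+ v. ennreal (j * exp (- j * v) * v powr - \<beta>) * indicator {0<..} v \<partial>lborel)
    = ennreal (j powr \<beta> * Gamma (1 - \<beta>))"
proof -
  have "ennreal (Gamma (1 - \<beta>)) =
      (\<integral>\<^sup>+ t. ennreal (indicator {0..} t * t powr (- \<beta>) / exp t) \<partial>lborel)"
    using Gamma_conv_nn_integral_real[of "1 - \<beta>"] assms by simp
  also have "\<dots> = \<bar>j\<bar> * (\<integral>\<^sup>+ v. ennreal (indicator {0..} (0 + j * v) * (0 + j * v) powr (- \<beta>) / exp (0 + j * v)) \<partial>lborel)"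
    by (rule nn_integral_real_affine) (use assms in auto)
  also have "\<dots> = (\<integral>\<^sup>+ v. ennreal j * ennreal (indicator {0..} (j * v) * (j * v) powr (- \<beta>) / exp (j * v)) \<partial>lborel)"
    using assms by (subst nn_integral_cmult) auto
  finally have "ennreal (j powr \<beta> * Gamma (1 - \<beta>)) = ennreal (j powr \<beta>) *
      (\<integral>\<^sup>+ v. ennreal j * ennreal (indicator {0..} (j * v) * (j * v) powr (- \<beta>) / exp (j * v)) \<partial>lborel)"
    by (simp add: ennreal_mult')
  also have "\<dots> = (\<integral>\<^sup>+ v. ennreal (j powr \<beta>) *
      (ennreal j * ennreal (indicator {0..} (j * v) * (j * v) powr (- \<beta>) / exp (j * v))) \<partial>lborel)"
    by (subst nn_integral_cmult) auto
  also have "\<dots> = (\<integral>\<^sup>+ v. ennreal (j * exp (- j * v) * v powr - \<beta>) * indicator {0<..} v \<partial>lborel)"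
  proof (rule nn_integral_cong)
    fix v :: real
    show "ennreal (j powr \<beta>) *
        (ennreal j * ennreal (indicator {0..} (j * v) * (j * v) powr (- \<beta>) / exp (j * v)))
      = ennreal (j * exp (- j * v) * v powr - \<beta>) * indicator {0<..} v"
    proof (cases "v > 0")
      case True
      have "j powr \<beta> * (j * ((j * v) powr (- \<beta>) / exp (j * v))) = j * exp (- j * v) * v powr - \<beta>"
        using True assms by (simp add: powr_mult powr_minus exp_minus field_simps)
      then show ?thesis
        using True assms by (simp flip: ennreal_mult')
    next
      case False
      then have "v < 0 \<or> v = 0" by auto
      then show ?thesis
        using assms by (auto simp: indicator_def zero_le_mult_iff)
    qed
  qed
  finally show ?thesis ..
qed

text \<open>
  Write \<open>1 - exp (- j * u)\<close> as the integral of \<open>j * exp (- j * v)\<close> over \<open>0 \<le> v \<le> u\<close> and exchange the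
  two integrations: the inner one becomes the tail \<open>v powr - \<beta>\<close> of the power law, and an
  Euler integral remains.
\<close>

lemma nn_integral_power_law_one_minus_exp:
  assumes "0 < \<beta>" "\<beta> < 1" "0 < j"
  shows "(\<integral>\<^sup>+ u. ennreal (1 - exp (- j * u)) \<partial>power_law \<beta>) = ennreal (j powr \<beta> * Gamma (1 - \<beta>))"
proof -
  have inner: "(\<integral>\<^sup>+ v. ennreal (j * exp (- j * v)) * indicator {0..u} v \<partial>lborel) = ennreal (1 - exp (- j * u))"
    if "0 < u" for u
  proof -
    have "(\<integral>\<^sup>+ v. ennreal (j * exp (- j * v)) * indicator {0..u} v \<partial>lborel)
        = ennreal (- exp (- j * u) - - exp (- j * 0))"
      by (rule nn_integral_FTC_Icc)
        (use that assms in \<open>auto intro!: derivative_eq_intros\<close>)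
    then show ?thesis by simp
  qed
  have "(\<integral>\<^sup>+ u. ennreal (1 - exp (- j * u)) \<partial>power_law \<beta>) =
     (\<integral>\<^sup>+ u. ennreal (\<beta> * u powr (- \<beta> - 1)) * indicator {0<..} u * ennreal (1 - exp (- j * u)) \<partial>lborel)"
    unfolding power_law_def by (subst nn_integral_density) auto
  also have "\<dots> = (\<integral>\<^sup>+ u. (\<integral>\<^sup>+ v. ennreal (\<beta> * u powr (- \<beta> - 1)) * indicator {0<..} u *
       (ennreal (j * exp (- j * v)) * indicator {0..u} v) \<partial>lborel) \<partial>lborel)"
    by (intro nn_integral_cong, subst nn_integral_cmult) (auto simp: inner[simplified] split: split_indicator)
  also have "\<dots> = (\<integral>\<^sup>+ v. (\<integral>\<^sup>+ u. ennreal (\<beta> * u powr (- \<beta> - 1)) * indicator {0<..} u *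
       (ennreal (j * exp (- j * v)) * indicator {0..u} v) \<partial>lborel) \<partial>lborel)"
    by (rule lborel_pair.Fubini') (simp add: split_beta' indicator_def)
  also have "\<dots> = (\<integral>\<^sup>+ v. ennreal (j * exp (- j * v) * v powr - \<beta>) * indicator {0<..} v \<partial>lborel)"
  proof (rule nn_integral_cong_AE, rule AE_mp[OF AE_lborel_singleton[of 0]], rule AE_I2, rule impI)
    fix v :: real assume "v \<noteq> 0"
    show "(\<integral>\<^sup>+ u. ennreal (\<beta> * u powr (- \<beta> - 1)) * indicator {0<..} u *
       (ennreal (j * exp (- j * v)) * indicator {0..u} v) \<partial>lborel)
      = ennreal (j * exp (- j * v) * v powr - \<beta>) * indicator {0<..} v"
    proof (cases "v > 0")
      case True
      have "(\<integral>\<^sup>+ u. ennreal (\<beta> * u powr (- \<beta> - 1)) * indicator {0<..} u *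
         (ennreal (j * exp (- j * v)) * indicator {0..u} v) \<partial>lborel)
       = (\<integral>\<^sup>+ u. ennreal (j * exp (- j * v)) * (ennreal (\<beta> * u powr (- \<beta> - 1)) * indicator {v..} u) \<partial>lborel)"
        using True by (intro nn_integral_cong) (auto split: split_indicator simp: mult.commute)
      also have "\<dots> = ennreal (j * exp (- j * v)) * ennreal (v powr - \<beta>)"
        using nn_integral_powr_tail[OF assms(1) True] by (subst nn_integral_cmult) auto
      finally show ?thesis
        using True assms by (simp add: ennreal_mult')
    next
      case False
      then show ?thesis
        using \<open>v \<noteq> 0\<close> by (auto simp: indicator_def)
    qed
  qed
  also have "\<dots> = ennreal (j powr \<beta> * Gamma (1 - \<beta>))"
    by (rule nn_integral_exp_powr) (use assms in auto)
  finally show ?thesis .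
qed

lemma AE_power_law_pos: "AE u in power_law \<beta>. 0 < u"
  unfolding power_law_def by (subst AE_density) (auto split: split_indicator)

lemma has_bochner_integral_power_law_one_minus_exp:
  assumes "0 < \<beta>" "\<beta> < 1" "0 < j"
  shows "has_bochner_integral (power_law \<beta>) (\<lambda>u. 1 - exp (- j * u)) (j powr \<beta> * Gamma (1 - \<beta>))"
proof (rule has_bochner_integral_nn_integral)
  show "AE u in power_law \<beta>. 0 \<le> 1 - exp (- j * u)"
    using AE_power_law_pos[of \<beta>] by eventually_elim (use assms in simp)
  show "0 \<le> j powr \<beta> * Gamma (1 - \<beta>)"
    using Gamma_real_pos[of "1 - \<beta>"] assms by simp
qed (use nn_integral_power_law_one_minus_exp[OF assms] in auto)

lemma has_bochner_integral_power_law_tail: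
  assumes "0 < \<beta>" "0 < r"
  shows "has_bochner_integral (power_law \<beta>) (indicator {r<..}) (r powr - \<beta>)"
proof -
  have "has_bochner_integral (power_law \<beta>) (indicator {r<..}) (measure (power_law \<beta>) {r<..})"
    using emeasure_power_law_tail[OF assms] by (intro has_bochner_integral_real_indicator) auto
  then show ?thesis
    using emeasure_power_law_tail[OF assms] by (simp add: measure_def)
qed

section \<open>Gaussian averages\<close>

text \<open>
  The substitution \<open>t = z\<^sup>2 / 2\<close> turns Euler's integral into the integral over the positive half-line;
  the integrand is even.
\<close>

lemma has_bochner_integral_std_normal_abs_powr:
  assumes "0 < \<gamma>"
  shows "has_bochner_integral std_normal_distribution (\<lambda>z. \<bar>z\<bar> powr \<gamma>)
    (2 powr (\<gamma> / 2) * Gamma ((\<gamma> + 1) / 2) / sqrt pi)"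
proof -
  define f where "f = (\<lambda>t::real. t powr ((\<gamma> + 1) / 2 - 1) / exp t)"
  have Gf: "f absolutely_integrable_on {0..}" "integral {0..} f = Gamma ((\<gamma> + 1) / 2)"
    using Gamma_integral_real[of "(\<gamma> + 1) / 2"] assms
    by (auto simp: f_def has_integral_iff intro!: nonnegative_absolutely_integrable_1)
  have img: "(\<lambda>z. z\<^sup>2 / 2) ` {0..} = {0::real..}"
  proof (intro equalityI subsetI)
    fix t :: real assume "t \<in> {0..}"
    then show "t \<in> (\<lambda>z. z\<^sup>2 / 2) ` {0..}"
      by (intro image_eqI[of _ _ "sqrt (2 * t)"]) auto
  qed auto
  have "(\<lambda>z. \<bar>z\<bar> * f (z\<^sup>2 / 2)) absolutely_integrable_on {0..} \<and>
      integral {0..} (\<lambda>z. \<bar>z\<bar> * f (z\<^sup>2 / 2)) = Gamma ((\<gamma> + 1) / 2)"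
    by (subst has_absolute_integral_change_of_variables_1')
      (use Gf img in \<open>auto intro!: derivative_eq_intros inj_onI simp: power2_eq_iff\<close>)
  then have "((\<lambda>z. \<bar>z\<bar> * f (z\<^sup>2 / 2)) has_integral Gamma ((\<gamma> + 1) / 2)) {0..}"
    by (auto simp: absolutely_integrable_on_def has_integral_iff)
  then have half: "(\<integral>\<^sup>+ z. ennreal (indicator {0..} z * (\<bar>z\<bar> * f (z\<^sup>2 / 2))) \<partial>lborel)
      = ennreal (Gamma ((\<gamma> + 1) / 2))"
    by (intro nn_integral_has_integral_lebesgue) (auto simp: f_def)
  \<comment> \<open>the factor between the Gaussian integrand and the one obtained from Euler's integral
    by the substitution \<open>t = z\<^sup>2 / 2\<close>\<close>
  define k where "k = 2 powr (\<gamma> / 2) / (2 * sqrt pi)"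
  have dens: "std_normal_density z * \<bar>z\<bar> powr \<gamma> = k * (\<bar>z\<bar> * f (z\<^sup>2 / 2))" if "0 \<le> z" for z
  proof (cases "z = 0")
    case False
    then have "0 < z"
      using that by simp
    have "(z\<^sup>2 / 2) powr ((\<gamma> + 1) / 2 - 1) = z powr (\<gamma> - 1) / 2 powr ((\<gamma> - 1) / 2)"
    proof -
      have "(z\<^sup>2) powr ((\<gamma> + 1) / 2 - 1) = z powr (\<gamma> - 1)"
      proof -
        have "(z powr 2) powr ((\<gamma> + 1) / 2 - 1) = z powr (2 * ((\<gamma> + 1) / 2 - 1))"
          by (simp only: powr_powr)
        also have "2 * ((\<gamma> + 1) / 2 - 1) = \<gamma> - 1"
          by (simp add: field_simps)
        finally show ?thesis
          using \<open>0 < z\<close> by simp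
      qed
      moreover have "(\<gamma> + 1) / 2 - 1 = (\<gamma> - 1) / 2"
        by (simp add: field_simps)
      ultimately show ?thesis
        using \<open>0 < z\<close> by (simp add: powr_divide)
    qed
    moreover have "2 powr ((\<gamma> - 1) / 2) = 2 powr (\<gamma> / 2) / sqrt 2"
      by (simp add: diff_divide_distrib powr_diff powr_half_sqrt)
    moreover have "z powr \<gamma> = z * z powr (\<gamma> - 1)"
      using \<open>0 < z\<close> by (simp add: powr_mult_base)
    moreover have "sqrt 2 * (sqrt 2 * x) = 2 * x" for x
      by (simp flip: mult.assoc)
    ultimately show ?thesis
      using \<open>0 < z\<close> by (simp add: k_def f_def normal_density_def exp_minus real_sqrt_mult field_simps)
  qed (use assms in simp)
  have "has_bochner_integral lborel (\<lambda>z. indicator {0..} z * (\<bar>z\<bar> * f (z\<^sup>2 / 2))) (Gamma ((\<gamma> + 1) / 2))"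
    by (rule has_bochner_integral_nn_integral)
      (use half Gamma_real_pos[of "(\<gamma> + 1) / 2"] assms in \<open>auto simp: f_def\<close>)
  then have "has_bochner_integral lborel (\<lambda>z. k * (indicator {0..} z * (\<bar>z\<bar> * f (z\<^sup>2 / 2))))
      (k * Gamma ((\<gamma> + 1) / 2))"
    by (intro has_bochner_integral_mult_right)
  also have "(\<lambda>z. k * (indicator {0..} z * (\<bar>z\<bar> * f (z\<^sup>2 / 2))))
      = (\<lambda>z. indicator {0..} z *\<^sub>R (std_normal_density z * \<bar>z\<bar> powr \<gamma>))"
  proof
    fix z :: real
    show "k * (indicator {0..} z * (\<bar>z\<bar> * f (z\<^sup>2 / 2)))
      = indicator {0..} z *\<^sub>R (std_normal_density z * \<bar>z\<bar> powr \<gamma>)"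
      using dens[of z] by (cases "0 \<le> z") auto
  qed
  finally have "has_bochner_integral lborel (\<lambda>z. std_normal_density z * \<bar>z\<bar> powr \<gamma>)
      (2 *\<^sub>R (k * Gamma ((\<gamma> + 1) / 2)))"
    by (rule has_bochner_integral_even_function) (simp add: normal_density_def)
  then have "has_bochner_integral std_normal_distribution (\<lambda>z. \<bar>z\<bar> powr \<gamma>) (2 *\<^sub>R (k * Gamma ((\<gamma> + 1) / 2)))"
    by (intro has_bochner_integral_density) auto
  then show ?thesis
    by (simp add: k_def)
qed

text \<open>
  This is where the tail constant enters: testing \<open>\<bar>\<theta>\<bar> powr \<gamma>\<close> against a Gaussian in \<open>\<theta>\<close> is the same
  as testing the jump intensity with \<open>1 - exp (- j * u)\<close>, up to the factor \<open>stable_tail_const \<gamma>\<close>.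
\<close>

lemma std_normal_abs_powr_eq_power_law:
  assumes "0 < \<gamma>" "\<gamma> < 2" "0 < j"
  shows "(LINT z|std_normal_distribution. \<bar>sqrt (2 * j) * z\<bar> powr \<gamma>)
    = stable_tail_const \<gamma> * (LINT u|power_law (\<gamma> / 2). 1 - exp (- j * u))"
proof -
  have "sqrt (2 * j) powr \<gamma> = 2 powr (\<gamma> / 2) * j powr (\<gamma> / 2)"
    using assms by (simp add: powr_powr powr_mult flip: powr_half_sqrt)
  moreover have "(2::real) powr (\<gamma> / 2) * 2 powr (\<gamma> / 2) = 2 powr \<gamma>"
    by (simp flip: powr_add)
  ultimately have "sqrt (2 * j) powr \<gamma> * (2 powr (\<gamma> / 2) * Gamma ((\<gamma> + 1) / 2) / sqrt pi)
      = j powr (\<gamma> / 2) * (2 powr \<gamma> * Gamma ((\<gamma> + 1) / 2) / sqrt pi)"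
    by (simp add: mult_ac)
  then show ?thesis
    using has_bochner_integral_integral_eq[OF has_bochner_integral_std_normal_abs_powr[of \<gamma>]]
      has_bochner_integral_integral_eq[OF has_bochner_integral_power_law_one_minus_exp[of "\<gamma> / 2" j]]
      stable_tail_const_Gaussian[of \<gamma>] assms
    by (simp add: abs_mult powr_mult mult_ac)
qed

lemma std_normal_cos: "(LINT z|std_normal_distribution. cos (x * z)) = exp (- (x\<^sup>2 / 2))"
proof -
  interpret N: real_distribution std_normal_distribution
    by (rule real_dist_normal_dist)
  have "Re (char std_normal_distribution x) = (LINT z|std_normal_distribution. Re (iexp (x * z)))"
    unfolding char_def by (rule integral_Re[symmetric, OF N.integrable_iexp]) auto
  then show ?thesis
    by (simp add: char_std_normal_distribution Re_exp)
qed

text \<open>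
  These weights dominate the first and second powers of the log-characteristic function, whose
  exponents stay below \<open>2\<close>.
\<close>

lemma integrable_std_normal_quadratic:
  "integrable std_normal_distribution (\<lambda>z. 1 + z\<^sup>2)"
  "integrable std_normal_distribution (\<lambda>z. (1 + z\<^sup>2)\<^sup>2)"
proof -
  interpret N: real_distribution std_normal_distribution
    by (rule real_dist_normal_dist)
  note m = integrable_std_normal_distribution_moment
  show "integrable std_normal_distribution (\<lambda>z. 1 + z\<^sup>2)"
    by (intro Bochner_Integration.integrable_add m) simp
  have "integrable std_normal_distribution (\<lambda>z. 1 + 2 * z\<^sup>2 + z ^ 4)"
    by (intro Bochner_Integration.integrable_add integrable_mult_right m) simp
  also have "(\<lambda>z. 1 + 2 * z\<^sup>2 + z ^ 4) = (\<lambda>z::real. (1 + z\<^sup>2)\<^sup>2)"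
    by (auto simp: fun_eq_iff power2_eq_square algebra_simps power4_eq_xxxx)
  finally show "integrable std_normal_distribution (\<lambda>z. (1 + z\<^sup>2)\<^sup>2)" .
qed

section \<open>One-sided approximation of a half-line\<close>

text \<open>
  Karamata's device. In the variable \<open>y = exp (- u)\<close> take a continuous step from \<open>1\<close> to \<open>0\<close> and
  approximate not the step itself but its quotient by \<open>1 - y\<close>. Multiplying back by \<open>1 - y\<close> gives a
  polynomial vanishing at \<open>y = 1\<close>, and the error carries the factor \<open>1 - exp (- u)\<close>, so it stays integrable
  against an intensity that is infinite near \<open>u = 0\<close>.
\<close>

lemma poly_exp_between_indicators:
  fixes r s \<delta> :: real
  assumes "0 < r" "r < s" "0 < \<delta>"
  obtains p :: "real poly" where "poly p 1 = 0"
    "\<And>u. 0 \<le> u \<Longrightarrow> indicator {s<..} u \<le> poly p (exp (- u))"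
    "\<And>u. 0 \<le> u \<Longrightarrow> poly p (exp (- u)) \<le> indicator {r<..} u + \<delta> * (1 - exp (- u))"
proof -
  define A B where "A = exp (- s)" and "B = exp (- r)"
  have AB: "A < B" "B < 1"
    using assms by (auto simp: A_def B_def)
  define st where "st y = min 1 (max 0 ((B - y) / (B - A)))" for y
  \<comment> \<open>truncating at \<open>B < 1\<close> keeps the quotient continuous at \<open>1\<close>; beyond \<open>B\<close> the step is \<open>0\<close> anyway\<close>
  define g where "g y = st y / (1 - min y B)" for y
  have g: "(1 - y) * g y = st y" for y
  proof (cases "y \<le> B")
    case False
    then have "st y = 0"
      using AB by (auto simp: st_def divide_nonpos_pos)
    then show ?thesis by (simp add: g_def)
  qed (use AB in \<open>simp add: g_def\<close>)
  \<comment> \<open>approximating the quotient shifted up by \<open>\<delta> / 2\<close> makes the approximation one-sided\<close>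
  have "continuous_on {0..1} (\<lambda>y. g y + \<delta> / 2)"
    unfolding g_def st_def using AB by (intro continuous_intros) auto
  then obtain q where "real_polynomial_function q"
    and q: "\<And>y. y \<in> {0..1} \<Longrightarrow> \<bar>g y + \<delta> / 2 - q y\<bar> < \<delta> / 2"
    using Stone_Weierstrass_real_polynomial_function[of "{0..1}" "\<lambda>y. g y + \<delta> / 2" "\<delta> / 2"] assms
    by auto
  then obtain c n where c: "q = (\<lambda>y. \<Sum>i\<le>n. c i * y ^ i)"
    using real_polynomial_function_iff_sum by blast
  define Q where "Q = (\<Sum>i\<le>n. monom (c i) i)"
  have Q: "poly Q y = q y" for y
    by (simp add: Q_def c poly_sum poly_monom)
  show ?thesis
  proof (rule that[of "[:1, -1:] * Q"])
    fix u :: real assume u: "0 \<le> u"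
    let ?y = "exp (- u)"
    have y: "?y \<in> {0..1}"
      using u by auto
    have st1: "st ?y = 1" if "s < u"
    proof -
      have "?y \<le> A" using that by (simp add: A_def)
      then show ?thesis using AB by (simp add: st_def)
    qed
    have st0: "st ?y = 0" if "u \<le> r"
    proof -
      have "B \<le> ?y" using that by (simp add: B_def)
      then show ?thesis using AB by (simp add: st_def divide_nonpos_pos)
    qed
    have st01: "0 \<le> st ?y" "st ?y \<le> 1"
      by (auto simp: st_def)
    have eq: "poly ([:1, -1:] * Q) ?y = (1 - ?y) * q ?y"
      by (simp add: Q algebra_simps)
    have q': "g ?y \<le> q ?y" "q ?y \<le> g ?y + \<delta>"
      using q[OF y] by linarith+
    have "indicator {s<..} u \<le> st ?y"
      using st1 st01 by (auto split: split_indicator)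
    also have "\<dots> \<le> (1 - ?y) * q ?y"
      unfolding g[symmetric] using q' u by (intro mult_left_mono) auto
    finally show "indicator {s<..} u \<le> poly ([:1, -1:] * Q) ?y"
      unfolding eq .
    have "(1 - ?y) * q ?y \<le> (1 - ?y) * (g ?y + \<delta>)"
      using q' u by (intro mult_left_mono) auto
    also have "\<dots> = st ?y + \<delta> * (1 - ?y)"
      by (simp only: distrib_left g mult.commute[of _ \<delta>])
    also have "\<dots> \<le> indicator {r<..} u + \<delta> * (1 - ?y)"
      using st0 st01 by (auto split: split_indicator)
    finally show "poly ([:1, -1:] * Q) ?y \<le> indicator {r<..} u + \<delta> * (1 - ?y)"
      unfolding eq .
  qed simp
qed

lemma poly_exp_eq_sum_one_minus_exp:
  fixes p :: "real poly"
  assumes "poly p 1 = 0"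
  shows "poly p (exp (- u)) = (\<Sum>j=1..degree p. - coeff p j * (1 - exp (- real j * u)))"
proof -
  have "poly p (exp (- u)) = poly p (exp (- u)) - poly p 1"
    using assms by simp
  also have "\<dots> = (\<Sum>j\<le>degree p. - coeff p j * (1 - exp (- real j * u)))"
    by (simp add: poly_altdef exp_of_nat_mult[symmetric] sum_subtractf[symmetric] algebra_simps)
  also have "\<dots> = (\<Sum>j=1..degree p. - coeff p j * (1 - exp (- real j * u)))"
    by (rule sum.mono_neutral_right) (auto simp: Suc_le_eq)
  finally show ?thesis .
qed

lemma has_bochner_integral_power_law_poly_exp:
  fixes p :: "real poly"
  assumes "0 < \<beta>" "\<beta> < 1" "poly p 1 = 0"
  shows "has_bochner_integral (power_law \<beta>) (\<lambda>u. poly p (exp (- u)))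
    (\<Sum>j=1..degree p. - coeff p j * (LINT u|power_law \<beta>. 1 - exp (- real j * u)))"
  unfolding poly_exp_eq_sum_one_minus_exp[OF assms(3)]
proof (rule has_bochner_integral_sum)
  fix j assume j: "j \<in> {1..degree p}"
  then have "integrable (power_law \<beta>) (\<lambda>u. 1 - exp (- real j * u))"
    using has_bochner_integral_power_law_one_minus_exp[of \<beta> "real j"] assms
    by (auto simp: has_bochner_integral_iff)
  then show "has_bochner_integral (power_law \<beta>) (\<lambda>u. - coeff p j * (1 - exp (- real j * u)))
      (- coeff p j * (LINT u|power_law \<beta>. 1 - exp (- real j * u)))"
    by (intro has_bochner_integral_mult_right) (auto simp: has_bochner_integral_iff)
qed

text \<open>
  The function that bounds the polynomials of Karamata's device from either side.
\<close>

lemma has_bochner_integral_power_law_tail_plus: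
  assumes "0 < \<beta>" "\<beta> < 1" "0 < r"
  shows "has_bochner_integral (power_law \<beta>) (\<lambda>u. indicator {r<..} u + \<delta> * (1 - exp (- u)))
      (r powr - \<beta> + \<delta> * Gamma (1 - \<beta>))"
  using has_bochner_integral_power_law_one_minus_exp[of \<beta> 1] assms
  by (intro has_bochner_integral_add has_bochner_integral_mult_right
      has_bochner_integral_power_law_tail) auto

lemma power_law_integral_lower_bound:
  fixes p :: "real poly"
  assumes "0 < \<beta>" "\<beta> < 1" "poly p 1 = 0" "0 < r"
    and "\<And>u. 0 \<le> u \<Longrightarrow> indicator {r<..} u + \<delta> * (1 - exp (- u)) \<le> poly p (exp (- u))"
  shows "r powr - \<beta> + \<delta> * Gamma (1 - \<beta>) \<le> (LINT u|power_law \<beta>. poly p (exp (- u)))"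
proof -
  have "AE u in power_law \<beta>. indicator {r<..} u + \<delta> * (1 - exp (- u)) \<le> poly p (exp (- u))"
    using AE_power_law_pos[of \<beta>] by eventually_elim (use assms(5) in simp)
  then show ?thesis
    using integral_mono_AE[of "power_law \<beta>" "\<lambda>u. indicator {r<..} u + \<delta> * (1 - exp (- u))"]
      has_bochner_integral_power_law_tail_plus[OF assms(1,2,4), of \<delta>]
      integrable.intros[OF has_bochner_integral_power_law_poly_exp[OF assms(1,2,3)]]
    by (simp add: has_bochner_integral_iff)
qed

lemma power_law_integral_upper_bound:
  fixes p :: "real poly"
  assumes "0 < \<beta>" "\<beta> < 1" "poly p 1 = 0" "0 < r"
    and "\<And>u. 0 \<le> u \<Longrightarrow> poly p (exp (- u)) \<le> indicator {r<..} u + \<delta> * (1 - exp (- u))"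
  shows "(LINT u|power_law \<beta>. poly p (exp (- u))) \<le> r powr - \<beta> + \<delta> * Gamma (1 - \<beta>)"
proof -
  have "AE u in power_law \<beta>. poly p (exp (- u)) \<le> indicator {r<..} u + \<delta> * (1 - exp (- u))"
    using AE_power_law_pos[of \<beta>] by eventually_elim (use assms(5) in simp)
  then show ?thesis
    using integral_mono_AE[of "power_law \<beta>" _ "\<lambda>u. indicator {r<..} u + \<delta> * (1 - exp (- u))"]
      has_bochner_integral_power_law_tail_plus[OF assms(1,2,4), of \<delta>]
      integrable.intros[OF has_bochner_integral_power_law_poly_exp[OF assms(1,2,3)]]
    by (simp add: has_bochner_integral_iff)
qed

text \<open>
  The mass of \<open>1 - exp (- u)\<close> under the power law with index \<open>\<beta>\<close> is \<open>Gamma (1 - \<beta>)\<close>, which blows up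
  only as \<open>\<beta>\<close> tends to \<open>1\<close>; exponents bounded away from \<open>2\<close> keep it under control.
\<close>

lemma Gamma_bound_near_one:
  assumes "b < (1::real)"
  obtains G where "0 < G" "\<And>\<beta>. \<beta> \<in> {0..b} \<Longrightarrow> Gamma (1 - \<beta>) \<le> G"
proof -
  have "continuous_on {1 - b..1} Gamma"
    using assms by (intro continuous_on_Gamma) (auto elim!: nonpos_Ints_cases)
  then have "bounded (Gamma ` {1 - b..1})"
    by (intro compact_imp_bounded compact_continuous_image) auto
  then obtain G where G: "0 < G" "\<And>x. x \<in> {1 - b..1} \<Longrightarrow> \<bar>Gamma x\<bar> \<le> G"
    unfolding bounded_pos by auto
  show ?thesis
  proof (rule that[of G])
    fix \<beta> assume "\<beta> \<in> {0..b}"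
    then show "Gamma (1 - \<beta>) \<le> G"
      using G(2)[of "1 - \<beta>"] by auto
  qed (rule G)
qed

text \<open>
  The power law with any index below \<open>1\<close> gives the half-lines above \<open>1 / s\<close> and above \<open>s\<close> masses between
  \<open>1 / s\<close> and \<open>s\<close>. One choice of \<open>s\<close> close to \<open>1\<close> therefore serves every exponent in \<open>{0<..b}\<close> at once,
  which is the source of the uniformity.
\<close>

lemma poly_exp_approximates_tail:
  assumes "0 < b" "b < 2" "0 < \<eta>"
  obtains p q :: "real poly" where "poly p 1 = 0" "poly q 1 = 0"
    "\<And>u. 0 \<le> u \<Longrightarrow> poly q (exp (- u)) \<le> indicator {1<..} u"
    "\<And>u. 0 \<le> u \<Longrightarrow> indicator {1<..} u \<le> poly p (exp (- u))"
    "\<And>\<gamma>. \<gamma> \<in> {0<..b} \<Longrightarrow> 1 - \<eta> \<le> (LINT u|power_law (\<gamma> / 2). poly q (exp (- u)))"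
    "\<And>\<gamma>. \<gamma> \<in> {0<..b} \<Longrightarrow> (LINT u|power_law (\<gamma> / 2). poly p (exp (- u))) \<le> 1 + \<eta>"
proof -
  obtain G where G: "0 < G" "\<And>\<beta>. \<beta> \<in> {0..b/2} \<Longrightarrow> Gamma (1 - \<beta>) \<le> G"
    using Gamma_bound_near_one[of "b / 2"] assms by auto
  define \<delta> where "\<delta> = \<eta> / (2 * G)"
  define s where "s = 1 + \<eta> / 2"
  have \<delta>: "0 < \<delta>" "1 < s"
    using assms G by (auto simp: \<delta>_def s_def)
  have \<delta>G: "\<delta> * Gamma (1 - \<gamma> / 2) \<le> \<eta> / 2" if "\<gamma> \<in> {0<..b}" for \<gamma>
  proof -
    have "\<delta> * Gamma (1 - \<gamma> / 2) \<le> \<delta> * G"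
      using G \<delta> that by (intro mult_left_mono) auto
    then show ?thesis
      using G by (simp add: \<delta>_def)
  qed
  obtain p where p: "poly p 1 = 0"
    "\<And>u. 0 \<le> u \<Longrightarrow> indicator {1<..} u \<le> poly p (exp (- u))"
    "\<And>u. 0 \<le> u \<Longrightarrow> poly p (exp (- u)) \<le> indicator {1 / s<..} u + \<delta> * (1 - exp (- u))"
    using poly_exp_between_indicators[of "1 / s" 1 \<delta>] \<delta> by auto
  obtain q where q: "poly q 1 = 0"
    "\<And>u. 0 \<le> u \<Longrightarrow> indicator {s<..} u \<le> poly q (exp (- u))"
    "\<And>u. 0 \<le> u \<Longrightarrow> poly q (exp (- u)) \<le> indicator {1<..} u + \<delta> * (1 - exp (- u))"
    using poly_exp_between_indicators[of 1 s \<delta>] \<delta> by auto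
  show ?thesis
  \<comment> \<open>subtracting \<open>\<delta> * (1 - y)\<close> turns the upper bound for \<open>q\<close> into a bound by the indicator itself\<close>
  proof (rule that[of p "q - smult \<delta> [:1, -1:]"])
    fix u :: real assume u: "0 \<le> u"
    show "poly (q - smult \<delta> [:1, -1:]) (exp (- u)) \<le> indicator {1<..} u"
      using q(3)[OF u] by (simp add: algebra_simps)
  next
    fix \<gamma> assume \<gamma>: "\<gamma> \<in> {0<..b}"
    have "s powr - 1 \<le> s powr - (\<gamma> / 2)"
      using \<delta> \<gamma> assms by (intro powr_mono) auto
    moreover have "1 - \<eta> / 2 \<le> s powr - 1"
      using assms by (simp add: s_def powr_minus divide_simps) (simp add: algebra_simps)
    moreover have "s powr - (\<gamma> / 2) + (- \<delta>) * Gamma (1 - \<gamma> / 2)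
        \<le> (LINT u|power_law (\<gamma> / 2). poly (q - smult \<delta> [:1, -1:]) (exp (- u)))"
      by (rule power_law_integral_lower_bound)
        (use \<gamma> assms \<delta> q in \<open>auto simp: algebra_simps\<close>)
    ultimately show "1 - \<eta> \<le> (LINT u|power_law (\<gamma> / 2). poly (q - smult \<delta> [:1, -1:]) (exp (- u)))"
      using \<delta>G[OF \<gamma>] by simp
    have "(1 / s) powr - (\<gamma> / 2) = s powr (\<gamma> / 2)"
      using \<delta> by (simp add: powr_divide powr_minus)
    moreover have "s powr (\<gamma> / 2) \<le> s powr 1"
      using \<delta> \<gamma> assms by (intro powr_mono) auto
    moreover have "(LINT u|power_law (\<gamma> / 2). poly p (exp (- u)))
        \<le> (1 / s) powr - (\<gamma> / 2) + \<delta> * Gamma (1 - \<gamma> / 2)"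
      by (rule power_law_integral_upper_bound) (use \<gamma> assms \<delta> p in auto)
    ultimately show "(LINT u|power_law (\<gamma> / 2). poly p (exp (- u))) \<le> 1 + \<eta>"
      using \<delta>G[OF \<gamma>] \<delta> by (simp add: s_def)
  qed (use p q in auto)
qed

section \<open>Characteristic functions of stable mixtures\<close>

text \<open>
  A variable \<open>X\<close> whose log-characteristic function is a mixture of the stable ones
  \<open>\<bar>\<theta>\<bar> powr \<gamma>\<close> under a probability \<open>\<nu>\<close> on the exponents. Only the real part of the characteristic function
  is recorded, since only \<open>X\<^sup>2\<close> is studied.
\<close>

locale stable_mixture = prob_space M + mixing: prob_space \<nu>
  for M :: "'w measure" and X :: "'w \<Rightarrow> real" and \<nu> :: "real measure" and a b :: real +
  assumes X [measurable]: "X \<in> borel_measurable M"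
    and sets_mixing [measurable_cong]: "sets \<nu> = sets borel"
    and exponents: "0 < a" "a \<le> b" "b < 2" "AE \<gamma> in \<nu>. \<gamma> \<in> {a..b}"
    and cos_char: "\<And>\<theta>. (LINT \<omega>|M. cos (\<theta> * X \<omega>)) = exp (- (LINT \<gamma>|\<nu>. \<bar>\<theta>\<bar> powr \<gamma>))"
begin

text \<open>
  The order of magnitude of the tail at level \<open>t\<close>, without the tail constants: every remainder below is
  measured in terms of it.
\<close>

definition mean_power :: "real \<Rightarrow> real" where
  "mean_power t = (LINT \<gamma>|\<nu>. t powr - \<gamma>)"

lemma integrable_mixing:
  assumes "g \<in> borel_measurable borel" "\<And>\<gamma>. \<gamma> \<in> {a..b} \<Longrightarrow> \<bar>g \<gamma>\<bar> \<le> B"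
  shows "integrable \<nu> (g :: real \<Rightarrow> real)"
proof (rule mixing.integrable_const_bound[of _ B])
  show "AE \<gamma> in \<nu>. norm (g \<gamma>) \<le> B"
    using exponents(4) by eventually_elim (use assms(2) in simp)
qed (use assms(1) sets_mixing in \<open>simp cong: measurable_cong_sets\<close>)

lemma powr_minus_le: "1 \<le> t \<Longrightarrow> \<gamma> \<in> {a..b} \<Longrightarrow> t powr - \<gamma> \<le> t powr - a"
  by (intro powr_mono) auto

lemma integrable_powr_minus: "1 \<le> t \<Longrightarrow> integrable \<nu> (\<lambda>\<gamma>. t powr - \<gamma>)"
  by (rule integrable_mixing[of _ "t powr - a"]) (auto intro: powr_minus_le)

lemma mean_power_le:
  assumes "1 \<le> t"
  shows "mean_power t \<le> t powr - a"
  unfolding mean_power_def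
proof (rule mixing.integral_le_const[OF integrable_powr_minus[OF assms]])
  show "AE \<gamma> in \<nu>. t powr - \<gamma> \<le> t powr - a"
    using exponents(4) by eventually_elim (use powr_minus_le[OF assms] in blast)
qed

lemma mean_power_pos:
  assumes "1 \<le> t"
  shows "0 < mean_power t"
proof -
  have "t powr - b \<le> mean_power t"
    unfolding mean_power_def
  proof (rule mixing.integral_ge_const[OF integrable_powr_minus[OF assms]])
    show "AE \<gamma> in \<nu>. t powr - b \<le> t powr - \<gamma>"
      using exponents(4) by eventually_elim (use assms in \<open>auto intro!: powr_mono\<close>)
  qed
  moreover have "0 < t powr - b"
    using assms by simp
  ultimately show ?thesis by linarith
qed

text \<open>
  Exponents in \<open>{0..2}\<close> give \<open>y powr \<gamma> \<le> max 1 (y\<^sup>2)\<close>, so the dependence on \<open>z\<close> is bounded by a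
  quadratic that does not involve \<open>\<gamma>\<close>, while the exact scaling \<open>t powr - \<gamma>\<close> is kept.
\<close>

lemma powr_scaled_le:
  assumes "1 \<le> c" "1 \<le> t" "\<gamma> \<in> {a..b}"
  shows "\<bar>c * z / t\<bar> powr \<gamma> \<le> c\<^sup>2 * (1 + z\<^sup>2) * t powr - \<gamma>"
proof -
  have "\<bar>c * z\<bar> powr \<gamma> \<le> c\<^sup>2 * (1 + z\<^sup>2)"
  proof (cases "\<bar>c * z\<bar> \<le> 1")
    case True
    have "\<bar>c * z\<bar> powr \<gamma> \<le> 1 powr \<gamma>"
      using True assms exponents by (intro powr_mono2) auto
    also have "\<dots> \<le> c\<^sup>2 * (1 + z\<^sup>2)"
      using mult_mono[of 1 "c\<^sup>2" 1 "1 + z\<^sup>2"] assms by simp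
    finally show ?thesis .
  next
    case False
    have "\<bar>c * z\<bar> powr \<gamma> \<le> \<bar>c * z\<bar> powr 2"
      using False assms exponents by (intro powr_mono) auto
    also have "\<dots> = c\<^sup>2 * z\<^sup>2"
      using False by (simp add: power_mult_distrib)
    also have "\<dots> \<le> c\<^sup>2 * (1 + z\<^sup>2)"
      by (intro mult_left_mono) auto
    finally show ?thesis .
  qed
  then have "\<bar>c * z\<bar> powr \<gamma> * t powr - \<gamma> \<le> c\<^sup>2 * (1 + z\<^sup>2) * t powr - \<gamma>"
    by (intro mult_right_mono) auto
  moreover have "\<bar>c * z / t\<bar> powr \<gamma> = \<bar>c * z\<bar> powr \<gamma> * t powr - \<gamma>"
    using assms by (simp add: abs_divide powr_divide powr_minus_divide)
  ultimately show ?thesis by simp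
qed

definition log_char :: "real \<Rightarrow> real" where
  "log_char \<theta> = (LINT \<gamma>|\<nu>. \<bar>\<theta>\<bar> powr \<gamma>)"

lemma log_char_nonneg: "0 \<le> log_char \<theta>"
  by (simp add: log_char_def)

lemma integrable_powr_scaled:
  assumes "1 \<le> c" "1 \<le> t"
  shows "integrable \<nu> (\<lambda>\<gamma>. \<bar>c * z / t\<bar> powr \<gamma>)"
proof (rule integrable_mixing[of _ "c\<^sup>2 * (1 + z\<^sup>2) * t powr - a"])
  fix \<gamma> assume \<gamma>: "\<gamma> \<in> {a..b}"
  have "c\<^sup>2 * (1 + z\<^sup>2) * t powr - \<gamma> \<le> c\<^sup>2 * (1 + z\<^sup>2) * t powr - a"
    using powr_minus_le[OF assms(2) \<gamma>] by (intro mult_left_mono) auto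
  then show "\<bar>\<bar>c * z / t\<bar> powr \<gamma>\<bar> \<le> c\<^sup>2 * (1 + z\<^sup>2) * t powr - a"
    using powr_scaled_le[OF assms \<gamma>, of z] by simp
qed auto

lemma log_char_scaled_le:
  assumes "1 \<le> c" "1 \<le> t"
  shows "log_char (c * z / t) \<le> c\<^sup>2 * (1 + z\<^sup>2) * mean_power t"
proof -
  have "log_char (c * z / t) \<le> (LINT \<gamma>|\<nu>. c\<^sup>2 * (1 + z\<^sup>2) * t powr - \<gamma>)"
    unfolding log_char_def
  proof (rule integral_mono_AE)
    show "AE \<gamma> in \<nu>. \<bar>c * z / t\<bar> powr \<gamma> \<le> c\<^sup>2 * (1 + z\<^sup>2) * t powr - \<gamma>"
      using exponents(4) by eventually_elim (rule powr_scaled_le[OF assms])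
  qed (use integrable_powr_scaled[OF assms] integrable_powr_minus[OF assms(2)] in auto)
  then show ?thesis
    by (simp add: mean_power_def)
qed

lemma log_char_measurable [measurable]: "log_char \<in> borel_measurable borel"
proof -
  have "(\<lambda>\<theta>. LINT \<gamma>|\<nu>. \<bar>\<theta>\<bar> powr \<gamma>) \<in> borel_measurable borel"
    by (rule mixing.borel_measurable_lebesgue_integral) measurable
  then show ?thesis
    by (simp add: log_char_def[abs_def])
qed

text \<open>
  The Gaussian is its own Fourier transform: \<open>exp (- j * y\<^sup>2)\<close> is the mean of \<open>cos (sqrt (2 * j) * y * Z)\<close>
  over a standard Gaussian \<open>Z\<close>. Exchanging the two expectations expresses the left side through
  the characteristic function.
\<close>

lemma expectation_one_minus_exp:
  assumes "0 < j"
  shows "(LINT \<omega>|M. 1 - exp (- j * (X \<omega> / t)\<^sup>2))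
    = (LINT z|std_normal_distribution. 1 - exp (- log_char (sqrt (2 * j) * z / t)))"
proof -
  interpret N: real_distribution std_normal_distribution
    by (rule real_dist_normal_dist)
  interpret P: pair_prob_space std_normal_distribution M ..
  have "(LINT \<omega>|M. 1 - exp (- j * (X \<omega> / t)\<^sup>2))
      = (LINT \<omega>|M. (LINT z|std_normal_distribution. 1 - cos (sqrt (2 * j) * (X \<omega> / t) * z)))"
  proof (rule Bochner_Integration.integral_cong[OF refl])
    fix \<omega>
    have "integrable std_normal_distribution (\<lambda>z. cos (sqrt (2 * j) * (X \<omega> / t) * z))"
      by (rule N.integrable_const_bound[of _ 1]) auto
    then have "(LINT z|std_normal_distribution. 1 - cos (sqrt (2 * j) * (X \<omega> / t) * z))
        = 1 - exp (- ((sqrt (2 * j) * (X \<omega> / t))\<^sup>2 / 2))"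
      using N.prob_space by (simp only: Bochner_Integration.integral_diff[OF N.integrable_const] std_normal_cos) simp
    also have "(sqrt (2 * j) * (X \<omega> / t))\<^sup>2 / 2 = j * (X \<omega> / t)\<^sup>2"
      using assms by (simp add: power_mult_distrib power_divide)
    finally show "1 - exp (- j * (X \<omega> / t)\<^sup>2)
        = (LINT z|std_normal_distribution. 1 - cos (sqrt (2 * j) * (X \<omega> / t) * z))"
      by simp
  qed
  also have "\<dots> = (LINT z|std_normal_distribution. (LINT \<omega>|M. 1 - cos (sqrt (2 * j) * (X \<omega> / t) * z)))"
  proof (rule P.Fubini_integral)
    show "integrable (std_normal_distribution \<Otimes>\<^sub>M M)
        (\<lambda>(z, \<omega>). 1 - cos (sqrt (2 * j) * (X \<omega> / t) * z))"
    proof (rule P.P.integrable_const_bound[of _ 2])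
      show "AE x in std_normal_distribution \<Otimes>\<^sub>M M.
          norm (case x of (z, \<omega>) \<Rightarrow> 1 - cos (sqrt (2 * j) * (X \<omega> / t) * z)) \<le> 2"
        by (auto split: prod.split intro!: AE_I2)
    qed measurable
  qed
  also have "\<dots> = (LINT z|std_normal_distribution. 1 - exp (- log_char (sqrt (2 * j) * z / t)))"
  proof (rule Bochner_Integration.integral_cong[OF refl])
    fix z :: real
    have "integrable M (\<lambda>\<omega>. cos (sqrt (2 * j) * z / t * X \<omega>))"
      by (rule integrable_const_bound[of _ 1]) auto
    then have "(LINT \<omega>|M. 1 - cos (sqrt (2 * j) * z / t * X \<omega>)) = 1 - exp (- log_char (sqrt (2 * j) * z / t))"
      using prob_space by (simp only: Bochner_Integration.integral_diff[OF integrable_const] cos_char log_char_def) simp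
    then show "(LINT \<omega>|M. 1 - cos (sqrt (2 * j) * (X \<omega> / t) * z)) = 1 - exp (- log_char (sqrt (2 * j) * z / t))"
      by (simp add: mult_ac)
  qed
  finally show ?thesis .
qed

lemma integrable_log_char:
  assumes "1 \<le> c" "1 \<le> t"
  shows "integrable std_normal_distribution (\<lambda>z. log_char (c * z / t))"
proof (rule Bochner_Integration.integrable_bound)
  show "integrable std_normal_distribution (\<lambda>z. c\<^sup>2 * (1 + z\<^sup>2) * mean_power t)"
    using integrable_std_normal_quadratic(1) by (intro integrable_mult_left integrable_mult_right)
  show "AE z in std_normal_distribution. norm (log_char (c * z / t)) \<le> norm (c\<^sup>2 * (1 + z\<^sup>2) * mean_power t)"
    using log_char_scaled_le[OF assms] log_char_nonneg mean_power_pos[OF assms(2)]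
    by (auto simp: abs_mult intro!: AE_I2)
qed measurable

text \<open>
  Fubini separates the scale \<open>t\<close> from the Gaussian moments.
\<close>

lemma has_bochner_integral_log_char:
  assumes "1 \<le> c" "1 \<le> t"
  shows "has_bochner_integral \<nu>
      (\<lambda>\<gamma>. t powr - \<gamma> * (LINT z|std_normal_distribution. \<bar>c * z\<bar> powr \<gamma>))
      (LINT z|std_normal_distribution. log_char (c * z / t))"
proof -
  interpret N: real_distribution std_normal_distribution
    by (rule real_dist_normal_dist)
  interpret P: pair_prob_space std_normal_distribution \<nu> ..
  have I: "integrable (std_normal_distribution \<Otimes>\<^sub>M \<nu>) (\<lambda>(z, \<gamma>). \<bar>c * z / t\<bar> powr \<gamma>)"
  proof (rule P.Fubini_integrable)
    show "integrable std_normal_distribution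
        (\<lambda>z. LINT \<gamma>|\<nu>. norm (case (z, \<gamma>) of (z, \<gamma>) \<Rightarrow> \<bar>c * z / t\<bar> powr \<gamma>))"
      using integrable_log_char[OF assms] by (simp add: log_char_def)
  qed (use integrable_powr_scaled[OF assms] in auto)
  have eq: "(LINT z|std_normal_distribution. \<bar>c * z / t\<bar> powr \<gamma>)
      = t powr - \<gamma> * (LINT z|std_normal_distribution. \<bar>c * z\<bar> powr \<gamma>)" for \<gamma>
  proof -
    have "\<bar>c * z / t\<bar> powr \<gamma> = t powr - \<gamma> * \<bar>c * z\<bar> powr \<gamma>" for z
      using assms by (simp add: abs_divide powr_divide powr_minus_divide)
    then show ?thesis by simp
  qed
  show ?thesis
    unfolding eq[symmetric] has_bochner_integral_iff log_char_def
    using P.integrable_snd[OF I] P.Fubini_integral[OF I] by simp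
qed

end

section \<open>Uniform tail asymptotics of stable mixtures\<close>

text \<open>
  What replaces \<open>1 - exp (- j * u)\<close> when the polynomial \<open>p\<close> with \<open>p(1) = 0\<close> is expanded in these functions
  and each of them is replaced by the Gaussian absolute moment that it contributes to first order.
\<close>

definition abs_moment_poly :: "real poly \<Rightarrow> real \<Rightarrow> real" where
  "abs_moment_poly p \<gamma> = (\<Sum>j=1..degree p. - coeff p j *
     (LINT z|std_normal_distribution. \<bar>sqrt (2 * real j) * z\<bar> powr \<gamma>))"

lemma abs_moment_poly_eq:
  assumes "0 < \<gamma>" "\<gamma> < 2" "poly p 1 = 0"
  shows "abs_moment_poly p \<gamma> =
    stable_tail_const \<gamma> * (LINT u|power_law (\<gamma> / 2). poly p (exp (- u)))"
proof -
  have "abs_moment_poly p \<gamma> = (\<Sum>j=1..degree p. stable_tail_const \<gamma> *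
      (- coeff p j * (LINT u|power_law (\<gamma> / 2). 1 - exp (- real j * u))))"
    unfolding abs_moment_poly_def
  proof (rule sum.cong[OF refl])
    fix j assume "j \<in> {1..degree p}"
    then show "- coeff p j * (LINT z|std_normal_distribution. \<bar>sqrt (2 * real j) * z\<bar> powr \<gamma>) =
        stable_tail_const \<gamma> * (- coeff p j * (LINT u|power_law (\<gamma> / 2). 1 - exp (- real j * u)))"
      using assms by (subst std_normal_abs_powr_eq_power_law) auto
  qed
  also have "\<dots> = stable_tail_const \<gamma> * (LINT u|power_law (\<gamma> / 2). poly p (exp (- u)))"
    using has_bochner_integral_integral_eq[OF has_bochner_integral_power_law_poly_exp[of "\<gamma> / 2" p]] assms
    by (simp only: sum_distrib_left[symmetric])
  finally show ?thesis .
qed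

text \<open>
  The second-order remainder of \<open>one_minus_exp_remainder\<close>, summed over the coefficients of the
  polynomial. Nothing in it refers to the mixture.
\<close>

definition remainder_const :: "real poly \<Rightarrow> real" where
  "remainder_const p = (\<Sum>j=1..degree p. \<bar>coeff p j\<bar> *
     (2 * (real j)\<^sup>2 * (LINT z|std_normal_distribution. (1 + z\<^sup>2)\<^sup>2)))"

lemma remainder_const_nonneg: "0 \<le> remainder_const p"
  unfolding remainder_const_def by (intro sum_nonneg mult_nonneg_nonneg Bochner_Integration.integral_nonneg) auto

lemma exp_minus_quadratic_bounds:
  fixes x :: real
  assumes "0 \<le> x"
  shows "0 \<le> x - (1 - exp (- x))" "x - (1 - exp (- x)) \<le> x\<^sup>2 / 2"
proof -
  show "0 \<le> x - (1 - exp (- x))"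
    using exp_ge_add_one_self[of "- x"] by simp
  have "exp (- x) - (1 - x + x\<^sup>2 / 2) \<le> exp (- 0) - (1 - 0 + 0\<^sup>2 / 2)"
  proof (rule DERIV_nonpos_imp_nonincreasing[OF assms])
    fix y :: real assume "0 \<le> y"
    show "\<exists>d. ((\<lambda>y. exp (- y) - (1 - y + y\<^sup>2 / 2)) has_real_derivative d) (at y) \<and> d \<le> 0"
      by (rule exI[of _ "- exp (- y) - (- 1 + y)"], safe)
        (use exp_ge_add_one_self[of "- y"] in \<open>auto intro!: derivative_eq_intros\<close>)
  qed
  then show "x - (1 - exp (- x)) \<le> x\<^sup>2 / 2"
    by simp
qed

context stable_mixture
begin

text \<open>
  Replace \<open>1 - exp (- \<psi>)\<close> by \<open>\<psi>\<close>. The error is at most \<open>\<psi>\<^sup>2 / 2\<close>, and \<open>\<psi>\<close> at scale \<open>1 / t\<close> is of the order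
  of \<open>mean_power t\<close>, so the error is quadratic in a quantity that tends to \<open>0\<close>.
\<close>

lemma one_minus_exp_remainder:
  assumes "1 \<le> j" "1 \<le> t"
  shows "\<bar>(LINT \<omega>|M. 1 - exp (- j * (X \<omega> / t)\<^sup>2))
      - (LINT \<gamma>|\<nu>. t powr - \<gamma> * (LINT z|std_normal_distribution. \<bar>sqrt (2 * j) * z\<bar> powr \<gamma>))\<bar>
    \<le> 2 * j\<^sup>2 * (LINT z|std_normal_distribution. (1 + z\<^sup>2)\<^sup>2) * (mean_power t)\<^sup>2"
proof -
  interpret N: real_distribution std_normal_distribution
    by (rule real_dist_normal_dist)
  define \<psi> where "\<psi> z = log_char (sqrt (2 * j) * z / t)" for z
  then have \<psi>_eq: "\<psi> = (\<lambda>z. log_char (sqrt (2 * j) * z / t))"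
    by (rule ext)
  have c: "1 \<le> sqrt (2 * j)"
    using assms by simp
  have \<psi>0: "0 \<le> \<psi> z" for z
    by (simp add: \<psi>_def log_char_nonneg)
  have [measurable]: "\<psi> \<in> borel_measurable borel"
    unfolding \<psi>_def by measurable
  have \<psi>_int: "integrable std_normal_distribution \<psi>"
    unfolding \<psi>_def by (rule integrable_log_char[OF c assms(2)])
  have e_int: "integrable std_normal_distribution (\<lambda>z. 1 - exp (- \<psi> z))"
    by (rule N.integrable_const_bound[of _ 1]) (auto simp: \<psi>0)
  have sq: "\<psi> z - (1 - exp (- \<psi> z)) \<le> 2 * j\<^sup>2 * (1 + z\<^sup>2)\<^sup>2 * (mean_power t)\<^sup>2" for z
  proof -
    have "\<psi> z \<le> 2 * j * (1 + z\<^sup>2) * mean_power t"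
      using log_char_scaled_le[OF c assms(2), of z] assms by (simp add: \<psi>_def)
    then have "(\<psi> z)\<^sup>2 \<le> (2 * j * (1 + z\<^sup>2) * mean_power t)\<^sup>2"
      using \<psi>0 by (intro power_mono)
    then show ?thesis
      using exp_minus_quadratic_bounds(2)[OF \<psi>0, of z] by (simp add: power_mult_distrib)
  qed
  have "(LINT \<gamma>|\<nu>. t powr - \<gamma> * (LINT z|std_normal_distribution. \<bar>sqrt (2 * j) * z\<bar> powr \<gamma>))
      - (LINT \<omega>|M. 1 - exp (- j * (X \<omega> / t)\<^sup>2))
      = (LINT z|std_normal_distribution. \<psi> z - (1 - exp (- \<psi> z)))"
    using has_bochner_integral_integral_eq[OF has_bochner_integral_log_char[OF c assms(2)]]
      expectation_one_minus_exp[of j t] assms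
      Bochner_Integration.integral_diff[OF \<psi>_int e_int]
    by (simp add: \<psi>_eq)
  moreover have "0 \<le> (LINT z|std_normal_distribution. \<psi> z - (1 - exp (- \<psi> z)))"
    by (intro Bochner_Integration.integral_nonneg exp_minus_quadratic_bounds(1) \<psi>0)
  moreover have "(LINT z|std_normal_distribution. \<psi> z - (1 - exp (- \<psi> z)))
      \<le> (LINT z|std_normal_distribution. 2 * j\<^sup>2 * (1 + z\<^sup>2)\<^sup>2 * (mean_power t)\<^sup>2)"
    using \<psi>_int e_int integrable_std_normal_quadratic(2) sq
    by (intro integral_mono integrable_mult_left integrable_mult_right) auto
  ultimately show ?thesis
    by (simp add: mult_ac)
qed

lemma poly_exp_remainder:
  assumes "poly p 1 = 0" "1 \<le> t"
  shows "integrable M (\<lambda>\<omega>. poly p (exp (- (X \<omega> / t)\<^sup>2)))"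
    and "integrable \<nu> (\<lambda>\<gamma>. t powr - \<gamma> * abs_moment_poly p \<gamma>)"
    and "\<bar>(LINT \<omega>|M. poly p (exp (- (X \<omega> / t)\<^sup>2))) - (LINT \<gamma>|\<nu>. t powr - \<gamma> * abs_moment_poly p \<gamma>)\<bar>
      \<le> remainder_const p * (mean_power t)\<^sup>2"
proof -
  let ?A = "\<lambda>j \<gamma>. LINT z|std_normal_distribution. \<bar>sqrt (2 * real j) * z\<bar> powr \<gamma>"
  let ?E = "\<lambda>j \<omega>. 1 - exp (- real j * (X \<omega> / t)\<^sup>2)"
  have E: "integrable M (?E j)" for j
    by (rule integrable_const_bound[of _ 1]) auto
  have A: "integrable \<nu> (\<lambda>\<gamma>. t powr - \<gamma> * ?A j \<gamma>)" if "1 \<le> j" for j :: nat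
    using has_bochner_integral_log_char[of "sqrt (2 * real j)" t] that assms
    by (simp add: has_bochner_integral_iff)
  have pE: "(\<lambda>\<omega>. poly p (exp (- (X \<omega> / t)\<^sup>2))) = (\<lambda>\<omega>. \<Sum>j=1..degree p. - coeff p j * ?E j \<omega>)"
    using poly_exp_eq_sum_one_minus_exp[OF assms(1)] by (simp add: fun_eq_iff)
  have pA: "(\<lambda>\<gamma>. t powr - \<gamma> * abs_moment_poly p \<gamma>)
      = (\<lambda>\<gamma>. \<Sum>j=1..degree p. - coeff p j * (t powr - \<gamma> * ?A j \<gamma>))"
    by (simp add: abs_moment_poly_def sum_distrib_left mult_ac)
  show "integrable M (\<lambda>\<omega>. poly p (exp (- (X \<omega> / t)\<^sup>2)))"
    unfolding pE by (intro Bochner_Integration.integrable_sum integrable_mult_right E)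
  show "integrable \<nu> (\<lambda>\<gamma>. t powr - \<gamma> * abs_moment_poly p \<gamma>)"
    unfolding pA by (intro Bochner_Integration.integrable_sum integrable_mult_right A) auto
  have sE: "(LINT \<omega>|M. poly p (exp (- (X \<omega> / t)\<^sup>2))) = (\<Sum>j=1..degree p. - coeff p j * (LINT \<omega>|M. ?E j \<omega>))"
    unfolding pE using E
    by (subst Bochner_Integration.integral_sum) (auto intro!: integrable_mult_right sum.cong simp del: mult_minus_left)
  have sA: "(LINT \<gamma>|\<nu>. t powr - \<gamma> * abs_moment_poly p \<gamma>)
      = (\<Sum>j=1..degree p. - coeff p j * (LINT \<gamma>|\<nu>. t powr - \<gamma> * ?A j \<gamma>))"
    unfolding pA using A
    by (subst Bochner_Integration.integral_sum) (auto intro!: integrable_mult_right sum.cong simp del: mult_minus_left)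
  have "\<bar>(LINT \<omega>|M. poly p (exp (- (X \<omega> / t)\<^sup>2))) - (LINT \<gamma>|\<nu>. t powr - \<gamma> * abs_moment_poly p \<gamma>)\<bar>
      = \<bar>\<Sum>j=1..degree p. - coeff p j * ((LINT \<omega>|M. ?E j \<omega>) - (LINT \<gamma>|\<nu>. t powr - \<gamma> * ?A j \<gamma>))\<bar>"
    unfolding sE sA by (simp add: sum_subtractf[symmetric] right_diff_distrib)
  also have "\<dots> \<le> (\<Sum>j=1..degree p. \<bar>- coeff p j * ((LINT \<omega>|M. ?E j \<omega>) - (LINT \<gamma>|\<nu>. t powr - \<gamma> * ?A j \<gamma>))\<bar>)"
    by (rule sum_abs)
  also have "\<dots> \<le> (\<Sum>j=1..degree p. \<bar>coeff p j\<bar> *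
      (2 * (real j)\<^sup>2 * (LINT z|std_normal_distribution. (1 + z\<^sup>2)\<^sup>2) * (mean_power t)\<^sup>2))"
  proof (rule sum_mono)
    fix j assume "j \<in> {1..degree p}"
    then show "\<bar>- coeff p j * ((LINT \<omega>|M. ?E j \<omega>) - (LINT \<gamma>|\<nu>. t powr - \<gamma> * ?A j \<gamma>))\<bar> \<le> \<bar>coeff p j\<bar> *
      (2 * (real j)\<^sup>2 * (LINT z|std_normal_distribution. (1 + z\<^sup>2)\<^sup>2) * (mean_power t)\<^sup>2)"
      unfolding abs_mult[of "- coeff p j"] abs_minus_cancel
      by (intro mult_left_mono one_minus_exp_remainder[OF _ assms(2)]) auto
  qed
  also have "\<dots> = remainder_const p * (mean_power t)\<^sup>2"
    by (simp add: remainder_const_def sum_distrib_right mult.assoc)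
  finally show "\<bar>(LINT \<omega>|M. poly p (exp (- (X \<omega> / t)\<^sup>2))) - (LINT \<gamma>|\<nu>. t powr - \<gamma> * abs_moment_poly p \<gamma>)\<bar>
      \<le> remainder_const p * (mean_power t)\<^sup>2" .
qed

text \<open>
  The claimed equivalent of the tail of \<open>X\<close>.
\<close>

definition mean_tail :: "real \<Rightarrow> real" where
  "mean_tail t = (LINT \<gamma>|\<nu>. t powr - \<gamma> * stable_tail_const \<gamma>)"

lemma integrable_mean_tail:
  assumes "1 \<le> t"
  shows "integrable \<nu> (\<lambda>\<gamma>. t powr - \<gamma> * stable_tail_const \<gamma>)"
proof -
  obtain K where K: "\<And>\<gamma>. \<gamma> \<in> {a..b} \<Longrightarrow> stable_tail_const \<gamma> \<le> K"
    using stable_tail_const_bounds[of a b] exponents by metis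
  show ?thesis
  proof (rule integrable_mixing[of _ "t powr - a * K"])
    fix \<gamma> assume \<gamma>: "\<gamma> \<in> {a..b}"
    then have "0 < stable_tail_const \<gamma>"
      using exponents by (intro stable_tail_const_pos) auto
    then show "\<bar>t powr - \<gamma> * stable_tail_const \<gamma>\<bar> \<le> t powr - a * K"
      using K[OF \<gamma>] powr_minus_le[OF assms \<gamma>] by (auto simp: abs_mult intro!: mult_mono)
  qed measurable
qed

lemma mean_power_le_mean_tail:
  assumes "1 \<le> t" "\<And>\<gamma>. \<gamma> \<in> {a..b} \<Longrightarrow> c \<le> stable_tail_const \<gamma>"
  shows "c * mean_power t \<le> mean_tail t"
proof -
  have "(LINT \<gamma>|\<nu>. c * t powr - \<gamma>) \<le> mean_tail t"
    unfolding mean_tail_def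
  proof (rule integral_mono_AE)
    show "AE \<gamma> in \<nu>. c * t powr - \<gamma> \<le> t powr - \<gamma> * stable_tail_const \<gamma>"
      using exponents(4) by eventually_elim (use assms in \<open>auto simp: mult.commute intro: mult_left_mono\<close>)
  qed (use integrable_powr_minus integrable_mean_tail assms in auto)
  then show ?thesis
    by (simp add: mean_power_def)
qed

lemma tail_indicator_eq:
  assumes "\<omega> \<in> space M" "1 \<le> t"
  shows "indicator {\<omega> \<in> space M. t < \<bar>X \<omega>\<bar>} \<omega> = (indicator {1<..} ((X \<omega> / t)\<^sup>2) :: real)"
  using assms abs_le_square_iff[of "X \<omega>" t] by (auto simp: indicator_def power_divide)

lemma integrable_tail_indicator:
  "integrable M (\<lambda>\<omega>. indicator {\<omega> \<in> space M. t < \<bar>X \<omega>\<bar>} \<omega> :: real)"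
  by (rule integrable_const_bound[of _ 1]) auto

text \<open>
  The event \<open>\<bar>X\<bar> > t\<close> is \<open>u > 1\<close> for \<open>u = (X / t)\<^sup>2\<close>, so a polynomial in \<open>exp (- u)\<close> above this
  indicator bounds its probability; to first order the mean of the polynomial is its integral against
  the jump intensities.
\<close>

lemma prob_tail_le:
  assumes "1 \<le> t" "poly p 1 = 0"
    and "\<And>u. 0 \<le> u \<Longrightarrow> indicator {1<..} u \<le> poly p (exp (- u))"
    and "\<And>\<gamma>. \<gamma> \<in> {0<..b} \<Longrightarrow> (LINT u|power_law (\<gamma> / 2). poly p (exp (- u))) \<le> 1 + \<eta>"
  shows "measure M {\<omega> \<in> space M. \<bar>X \<omega>\<bar> > t}
    \<le> (1 + \<eta>) * mean_tail t + remainder_const p * (mean_power t)\<^sup>2"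
proof -
  have "measure M {\<omega> \<in> space M. \<bar>X \<omega>\<bar> > t} = (LINT \<omega>|M. indicator {\<omega> \<in> space M. \<bar>X \<omega>\<bar> > t} \<omega>)"
    by simp
  also have "\<dots> \<le> (LINT \<omega>|M. poly p (exp (- (X \<omega> / t)\<^sup>2)))"
  proof (rule integral_mono)
    fix \<omega> assume "\<omega> \<in> space M"
    then show "indicator {\<omega> \<in> space M. \<bar>X \<omega>\<bar> > t} \<omega> \<le> poly p (exp (- (X \<omega> / t)\<^sup>2))"
      using assms(3)[of "(X \<omega> / t)\<^sup>2"] tail_indicator_eq[OF _ assms(1)] by simp
  qed (use poly_exp_remainder(1)[OF assms(2,1)] integrable_tail_indicator in auto)
  also have "\<dots> \<le> (LINT \<gamma>|\<nu>. t powr - \<gamma> * abs_moment_poly p \<gamma>) + remainder_const p * (mean_power t)\<^sup>2"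
    using poly_exp_remainder(3)[OF assms(2,1)] by linarith
  also have "(LINT \<gamma>|\<nu>. t powr - \<gamma> * abs_moment_poly p \<gamma>)
      \<le> (LINT \<gamma>|\<nu>. (1 + \<eta>) * (t powr - \<gamma> * stable_tail_const \<gamma>))"
  proof (rule integral_mono_AE)
    show "AE \<gamma> in \<nu>. t powr - \<gamma> * abs_moment_poly p \<gamma> \<le> (1 + \<eta>) * (t powr - \<gamma> * stable_tail_const \<gamma>)"
      using exponents(4)
    proof eventually_elim
      fix \<gamma> assume \<gamma>: "\<gamma> \<in> {a..b}"
      have "0 < stable_tail_const \<gamma>"
        using \<gamma> exponents by (intro stable_tail_const_pos) auto
      then have "abs_moment_poly p \<gamma> \<le> stable_tail_const \<gamma> * (1 + \<eta>)"
        using assms(4)[of \<gamma>] \<gamma> exponents assms(2) by (subst abs_moment_poly_eq) auto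
      then have "t powr - \<gamma> * abs_moment_poly p \<gamma> \<le> t powr - \<gamma> * (stable_tail_const \<gamma> * (1 + \<eta>))"
        by (intro mult_left_mono) auto
      then show "t powr - \<gamma> * abs_moment_poly p \<gamma> \<le> (1 + \<eta>) * (t powr - \<gamma> * stable_tail_const \<gamma>)"
        by (simp only: mult_ac)
    qed
  qed (use poly_exp_remainder(2)[OF assms(2,1)] integrable_mean_tail[OF assms(1)] in auto)
  finally show ?thesis
    by (simp add: mean_tail_def)
qed

lemma prob_tail_ge:
  assumes "1 \<le> t" "poly p 1 = 0"
    and "\<And>u. 0 \<le> u \<Longrightarrow> poly p (exp (- u)) \<le> indicator {1<..} u"
    and "\<And>\<gamma>. \<gamma> \<in> {0<..b} \<Longrightarrow> 1 - \<eta> \<le> (LINT u|power_law (\<gamma> / 2). poly p (exp (- u)))"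
  shows "(1 - \<eta>) * mean_tail t - remainder_const p * (mean_power t)\<^sup>2
    \<le> measure M {\<omega> \<in> space M. \<bar>X \<omega>\<bar> > t}"
proof -
  have "(1 - \<eta>) * mean_tail t = (LINT \<gamma>|\<nu>. (1 - \<eta>) * (t powr - \<gamma> * stable_tail_const \<gamma>))"
    by (simp add: mean_tail_def)
  also have "\<dots> \<le> (LINT \<gamma>|\<nu>. t powr - \<gamma> * abs_moment_poly p \<gamma>)"
  proof (rule integral_mono_AE)
    show "AE \<gamma> in \<nu>. (1 - \<eta>) * (t powr - \<gamma> * stable_tail_const \<gamma>) \<le> t powr - \<gamma> * abs_moment_poly p \<gamma>"
      using exponents(4)
    proof eventually_elim
      fix \<gamma> assume \<gamma>: "\<gamma> \<in> {a..b}"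
      have "0 < stable_tail_const \<gamma>"
        using \<gamma> exponents by (intro stable_tail_const_pos) auto
      then have "stable_tail_const \<gamma> * (1 - \<eta>) \<le> abs_moment_poly p \<gamma>"
        using assms(4)[of \<gamma>] \<gamma> exponents assms(2) by (subst abs_moment_poly_eq) auto
      then have "t powr - \<gamma> * (stable_tail_const \<gamma> * (1 - \<eta>)) \<le> t powr - \<gamma> * abs_moment_poly p \<gamma>"
        by (intro mult_left_mono) auto
      then show "(1 - \<eta>) * (t powr - \<gamma> * stable_tail_const \<gamma>) \<le> t powr - \<gamma> * abs_moment_poly p \<gamma>"
        by (simp only: mult_ac)
    qed
  qed (use poly_exp_remainder(2)[OF assms(2,1)] integrable_mean_tail[OF assms(1)] in auto)
  also have "\<dots> \<le> (LINT \<omega>|M. poly p (exp (- (X \<omega> / t)\<^sup>2))) + remainder_const p * (mean_power t)\<^sup>2"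
    using poly_exp_remainder(3)[OF assms(2,1)] by linarith
  also have "(LINT \<omega>|M. poly p (exp (- (X \<omega> / t)\<^sup>2)))
      \<le> (LINT \<omega>|M. indicator {\<omega> \<in> space M. \<bar>X \<omega>\<bar> > t} \<omega>)"
  proof (rule integral_mono)
    fix \<omega> assume "\<omega> \<in> space M"
    then show "poly p (exp (- (X \<omega> / t)\<^sup>2)) \<le> indicator {\<omega> \<in> space M. \<bar>X \<omega>\<bar> > t} \<omega>"
      using assms(3)[of "(X \<omega> / t)\<^sup>2"] tail_indicator_eq[OF _ assms(1)] by simp
  qed (use poly_exp_remainder(1)[OF assms(2,1)] integrable_tail_indicator in auto)
  finally show ?thesis
    by simp
qed

end

text \<open>
  The polynomials depend only on \<open>\<eta>\<close> and \<open>b\<close>. Relative to \<open>mean_tail t\<close>, their remainders are of the order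
  of \<open>mean_power t \<le> t powr - a\<close>, because \<open>stable_tail_const\<close> is bounded below on \<open>{a..b}\<close>. Hence the threshold does
  not depend on the mixture.
\<close>

lemma stable_mixture_tail_uniform:
  fixes a b \<eta> :: real
  assumes ab: "0 < a" "a \<le> b" "b < 2" and \<eta>: "0 < \<eta>"
  obtains t\<^sub>0 :: real where
    "\<And>(M :: 'w measure) X \<nu> t. stable_mixture M X \<nu> a b \<Longrightarrow> t\<^sub>0 \<le> t \<Longrightarrow>
      \<bar>measure M {\<omega> \<in> space M. \<bar>X \<omega>\<bar> > t} / (LINT \<gamma>|\<nu>. t powr - \<gamma> * stable_tail_const \<gamma>) - 1\<bar> \<le> \<eta>"
proof -
  have b0: "0 < b"
    using ab by simp
  obtain p q :: "real poly" where pq: "poly p 1 = 0" "poly q 1 = 0"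
    "\<And>u. 0 \<le> u \<Longrightarrow> poly q (exp (- u)) \<le> indicator {1<..} u"
    "\<And>u. 0 \<le> u \<Longrightarrow> indicator {1<..} u \<le> poly p (exp (- u))"
    "\<And>\<gamma>. \<gamma> \<in> {0<..b} \<Longrightarrow> 1 - \<eta> / 2 \<le> (LINT u|power_law (\<gamma> / 2). poly q (exp (- u)))"
    "\<And>\<gamma>. \<gamma> \<in> {0<..b} \<Longrightarrow> (LINT u|power_law (\<gamma> / 2). poly p (exp (- u))) \<le> 1 + \<eta> / 2"
    using poly_exp_approximates_tail[OF b0 ab(3) half_gt_zero[OF \<eta>]] by blast
  obtain c where c: "0 < c" "\<And>\<gamma>. \<gamma> \<in> {a..b} \<Longrightarrow> c \<le> stable_tail_const \<gamma>"
    using stable_tail_const_bounds[OF ab] by metis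
  define K where "K = remainder_const p + remainder_const q"
  have K: "0 \<le> K"
    by (simp add: K_def remainder_const_nonneg)
  have "((\<lambda>t. K * t powr - a / c) \<longlongrightarrow> K * 0 / c) at_top"
    by (intro tendsto_intros tendsto_neg_powr filterlim_ident) (use ab c in auto)
  then have "eventually (\<lambda>t. K * t powr - a / c < \<eta> / 2) at_top"
    by (rule order_tendstoD) (use \<eta> in simp)
  then obtain T where T: "\<And>t. T \<le> t \<Longrightarrow> K * t powr - a / c < \<eta> / 2"
    unfolding eventually_at_top_linorder by auto
  show ?thesis
  proof (rule that[of "max 1 T"])
    fix M :: "'w measure" and X \<nu> t
    assume "stable_mixture M X \<nu> a b" and t: "max 1 T \<le> t"
    then interpret stable_mixture M X \<nu> a b
      by simp
    have t1: "1 \<le> t"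
      using t by simp
    let ?P = "measure M {\<omega> \<in> space M. \<bar>X \<omega>\<bar> > t}"
    note S = mean_power_pos[OF t1] mean_power_le[OF t1] mean_power_le_mean_tail[OF t1 c(2)]
    have pos: "0 < mean_tail t"
      using S c(1) by (meson less_le_trans mult_pos_pos)
    have "K * (mean_power t)\<^sup>2 \<le> K * t powr - a / c * (c * mean_power t)"
      using mult_left_mono[OF mult_right_mono[OF S(2), of "mean_power t"] K] S(1) c(1)
      by (simp add: power2_eq_square mult_ac)
    also have "\<dots> \<le> \<eta> / 2 * mean_tail t"
      using T[of t] t S c(1) K \<eta> by (intro mult_mono) auto
    finally have rem: "K * (mean_power t)\<^sup>2 \<le> \<eta> / 2 * mean_tail t" .
    have "remainder_const p * (mean_power t)\<^sup>2 \<le> K * (mean_power t)\<^sup>2"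
      "remainder_const q * (mean_power t)\<^sup>2 \<le> K * (mean_power t)\<^sup>2"
      by (intro mult_right_mono; simp add: K_def remainder_const_nonneg)+
    then have "?P \<le> (1 + \<eta> / 2) * mean_tail t + \<eta> / 2 * mean_tail t"
      "(1 - \<eta> / 2) * mean_tail t - \<eta> / 2 * mean_tail t \<le> ?P"
      using prob_tail_le[OF t1 pq(1) pq(4) pq(6)] prob_tail_ge[OF t1 pq(2) pq(3) pq(5)] rem
      by linarith+
    then have "\<bar>?P - mean_tail t\<bar> \<le> \<eta> * mean_tail t"
      by (simp add: algebra_simps abs_le_iff)
    moreover have "\<bar>?P / mean_tail t - 1\<bar> = \<bar>?P - mean_tail t\<bar> / mean_tail t"
    proof -
      have "?P / mean_tail t - 1 = (?P - mean_tail t) / mean_tail t"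
        using pos by (simp add: diff_divide_distrib)
      then show ?thesis
        using pos by simp
    qed
    ultimately have "\<bar>?P / mean_tail t - 1\<bar> \<le> \<eta>"
      using pos by (simp add: divide_le_eq)
    then show "\<bar>?P / (LINT \<gamma>|\<nu>. t powr - \<gamma> * stable_tail_const \<gamma>) - 1\<bar> \<le> \<eta>"
      unfolding mean_tail_def .
  qed
qed

section \<open>The unit sphere of the variable exponent space\<close>

text \<open>
  The modular of the variable exponent space: the norm is the scale at which it equals \<open>1\<close>.
\<close>

definition modular :: "(real \<Rightarrow> real) \<Rightarrow> (real \<Rightarrow> real) \<Rightarrow> real \<Rightarrow> real" where
  "modular \<alpha> f l = (LINT x|lebesgue. \<bar>inverse l * f x\<bar> powr \<alpha> x)"

locale variable_exponent =
  fixes \<alpha> :: "real \<Rightarrow> real" and a :: real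
  assumes a_pos: "0 < a" and \<alpha>_meas [measurable]: "\<alpha> \<in> borel_measurable lebesgue"
    and \<alpha>_range: "\<And>x. \<alpha> x \<in> {a..2}"
begin

lemma varexp_space_measurable: "f \<in> varexp_space \<alpha> \<Longrightarrow> f \<in> borel_measurable lebesgue"
  by (simp add: varexp_space_def)

lemma powr_scale_le:
  assumes "0 < l" "l \<le> m"
  shows "\<bar>inverse m * y\<bar> powr \<alpha> x \<le> (l / m) powr a * \<bar>inverse l * y\<bar> powr \<alpha> x"
proof -
  have "\<bar>inverse m * y\<bar> powr \<alpha> x = ((l / m) * \<bar>inverse l * y\<bar>) powr \<alpha> x"
  proof -
    have "inverse m * \<bar>y\<bar> = l / m * (inverse l * \<bar>y\<bar>)"
      using assms by (simp add: field_simps)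
    then show ?thesis
      using assms by (simp add: abs_mult)
  qed
  also have "\<dots> = (l / m) powr \<alpha> x * \<bar>inverse l * y\<bar> powr \<alpha> x"
    by (rule powr_mult)
  also have "\<dots> \<le> (l / m) powr a * \<bar>inverse l * y\<bar> powr \<alpha> x"
    using assms \<alpha>_range[of x] by (intro mult_right_mono powr_mono') auto
  finally show ?thesis .
qed

lemma integrable_modular:
  assumes f: "f \<in> varexp_space \<alpha>" and "0 < l"
  shows "integrable lebesgue (\<lambda>x. \<bar>inverse l * f x\<bar> powr \<alpha> x)"
proof -
  note [measurable] = varexp_space_measurable[OF f]
  have "integrable lebesgue (\<lambda>x. \<bar>f x\<bar> powr \<alpha> x)"
    using f by (intro integrableI_nonneg) (auto simp: varexp_space_def)
  then have "integrable lebesgue (\<lambda>x. max 1 (inverse l ^ 2) * \<bar>f x\<bar> powr \<alpha> x)"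
    by simp
  then show ?thesis
  proof (rule Bochner_Integration.integrable_bound)
    show "AE x in lebesgue. norm (\<bar>inverse l * f x\<bar> powr \<alpha> x)
        \<le> norm (max 1 (inverse l ^ 2) * \<bar>f x\<bar> powr \<alpha> x)"
    proof (rule AE_I2)
      fix x
      have "inverse l powr \<alpha> x \<le> max 1 (inverse l ^ 2)"
      proof (cases "inverse l \<le> 1")
        case True
        then have "inverse l powr \<alpha> x \<le> 1"
          using \<open>0 < l\<close> \<alpha>_range[of x] a_pos by (intro powr_le1) auto
        then show ?thesis by simp
      next
        case False
        then have "inverse l powr \<alpha> x \<le> inverse l powr 2"
          using \<alpha>_range[of x] by (intro powr_mono) auto
        then show ?thesis
          using \<open>0 < l\<close> by (simp add: power_inverse)
      qed
      then have "inverse l powr \<alpha> x * \<bar>f x\<bar> powr \<alpha> x \<le> max 1 (inverse l ^ 2) * \<bar>f x\<bar> powr \<alpha> x"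
        by (intro mult_right_mono) auto
      then show "norm (\<bar>inverse l * f x\<bar> powr \<alpha> x) \<le> norm (max 1 (inverse l ^ 2) * \<bar>f x\<bar> powr \<alpha> x)"
        using \<open>0 < l\<close> by (simp add: abs_mult powr_mult)
    qed
  qed measurable
qed

lemma modular_nonneg: "0 \<le> modular \<alpha> f l"
  by (simp add: modular_def)

text \<open>
  Since the exponents are at least \<open>a > 0\<close>, the modular decreases strictly in the scale wherever it is
  positive. This gives both the uniqueness of the scale with modular \<open>1\<close> and the bracket in which
  it is found.
\<close>

lemma modular_scale_le:
  assumes f: "f \<in> varexp_space \<alpha>" and lm: "0 < l" "l \<le> m"
  shows "modular \<alpha> f m \<le> (l / m) powr a * modular \<alpha> f l"
proof -
  have "modular \<alpha> f m \<le> (LINT x|lebesgue. (l / m) powr a * \<bar>inverse l * f x\<bar> powr \<alpha> x)"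
    unfolding modular_def
    using integrable_modular[OF f] lm powr_scale_le[OF lm]
    by (intro integral_mono integrable_mult_right) auto
  then show ?thesis
    by (simp add: modular_def)
qed

lemma modular_eq_1_unique:
  assumes f: "f \<in> varexp_space \<alpha>"
    and "0 < l" "modular \<alpha> f l = 1" "0 < m" "modular \<alpha> f m = 1"
  shows "l = m"
proof -
  have *: "\<not> l < m" if "0 < l" "modular \<alpha> f l = 1" "modular \<alpha> f m = 1" for l m
  proof
    assume "l < m"
    then have "(l / m) powr a < 1 powr a"
      using that a_pos by (intro powr_less_mono2) auto
    then show False
      using modular_scale_le[OF f, of l m] \<open>l < m\<close> that by simp
  qed
  show ?thesis
    using *[of l m] *[of m l] assms by linarith
qed

lemma continuous_on_modular:
  assumes f: "f \<in> varexp_space \<alpha>" and "0 < r"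
  shows "continuous_on {r..s} (modular \<alpha> f)"
proof (rule continuous_on_sequentiallyI)
  note [measurable] = varexp_space_measurable[OF f]
  fix u l assume u: "\<forall>n. u n \<in> {r..s}" and l: "l \<in> {r..s}" and lim: "u \<longlonglongrightarrow> l"
  show "(\<lambda>n. modular \<alpha> f (u n)) \<longlonglongrightarrow> modular \<alpha> f l"
    unfolding modular_def
  proof (rule integral_dominated_convergence)
    show "integrable lebesgue (\<lambda>x. \<bar>inverse r * f x\<bar> powr \<alpha> x)"
      by (rule integrable_modular[OF assms])
    show "AE x in lebesgue. (\<lambda>n. \<bar>inverse (u n) * f x\<bar> powr \<alpha> x) \<longlonglongrightarrow> \<bar>inverse l * f x\<bar> powr \<alpha> x"
    proof (rule AE_I2)
      fix x
      show "(\<lambda>n. \<bar>inverse (u n) * f x\<bar> powr \<alpha> x) \<longlonglongrightarrow> \<bar>inverse l * f x\<bar> powr \<alpha> x"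
        using l \<open>0 < r\<close> \<alpha>_range[of x] a_pos
        by (intro tendsto_powr' tendsto_intros lim) auto
    qed
    show "AE x in lebesgue. norm (\<bar>inverse (u n) * f x\<bar> powr \<alpha> x) \<le> \<bar>inverse r * f x\<bar> powr \<alpha> x" for n
    proof (rule AE_I2)
      fix x
      have "\<bar>inverse (u n) * f x\<bar> \<le> \<bar>inverse r * f x\<bar>"
        using u \<open>0 < r\<close> by (auto simp: abs_mult intro!: mult_right_mono le_imp_inverse_le)
          (metis abs_of_pos le_imp_inverse_le less_le_trans positive_imp_inverse_positive)
      then show "norm (\<bar>inverse (u n) * f x\<bar> powr \<alpha> x) \<le> \<bar>inverse r * f x\<bar> powr \<alpha> x"
        using \<alpha>_range[of x] a_pos by (auto intro!: powr_mono2)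
    qed
  qed measurable
qed

lemma modular_eq_1_exists:
  assumes f: "f \<in> varexp_space \<alpha>" and nz: "\<not> (AE x in lebesgue. f x = 0)"
  shows "\<exists>l>0. modular \<alpha> f l = 1"
proof -
  note [measurable] = varexp_space_measurable[OF f]
  have "modular \<alpha> f 1 \<noteq> 0"
    using integral_nonneg_eq_0_iff_AE[OF integrable_modular[OF f, of 1]] nz
    by (simp add: modular_def)
  then have F1: "0 < modular \<alpha> f 1"
    using modular_nonneg[of f 1] by linarith
  \<comment> \<open>by the power bound of \<open>modular_scale_le\<close>, the value \<open>1\<close> is attained between \<open>1\<close> and \<open>l\<^sub>0\<close>\<close>
  define l\<^sub>0 where "l\<^sub>0 = modular \<alpha> f 1 powr (1 / a)"
  have l0: "0 < l\<^sub>0" "l\<^sub>0 powr a = modular \<alpha> f 1"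
    using F1 a_pos by (auto simp: l\<^sub>0_def powr_powr)
  show ?thesis
  proof (cases "1 \<le> l\<^sub>0")
    case True
    have "modular \<alpha> f l\<^sub>0 \<le> (1 / l\<^sub>0) powr a * modular \<alpha> f 1"
      by (rule modular_scale_le[OF f]) (use True in auto)
    also have "\<dots> = 1"
      using l0 F1 by (simp add: powr_divide)
    finally have "modular \<alpha> f l\<^sub>0 \<le> 1" .
    moreover have "1 \<le> modular \<alpha> f 1"
      using ge_one_powr_ge_zero[OF True, of a] a_pos l0 by simp
    ultimately obtain l where "1 \<le> l" "modular \<alpha> f l = 1"
      using IVT2'[of "modular \<alpha> f" l\<^sub>0 1 1] True continuous_on_modular[OF f, of 1 l\<^sub>0] by auto
    then show ?thesis
      by (intro exI[of _ l]) auto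
  next
    case False
    have "modular \<alpha> f 1 \<le> (l\<^sub>0 / 1) powr a * modular \<alpha> f l\<^sub>0"
      by (rule modular_scale_le[OF f]) (use False l0 in auto)
    then have "1 \<le> modular \<alpha> f l\<^sub>0"
      using l0 F1 by simp
    moreover have "modular \<alpha> f 1 \<le> 1"
      using powr_le1[of a l\<^sub>0] False a_pos l0 by simp
    ultimately obtain l where "l\<^sub>0 \<le> l" "modular \<alpha> f l = 1"
      using IVT2'[of "modular \<alpha> f" 1 1 l\<^sub>0] False continuous_on_modular[OF f, of l\<^sub>0 1] l0 by auto
    then show ?thesis
      using l0 by (intro exI[of _ l]) auto
  qed
qed

text \<open>
  The norm is a definite description, so its value carries information only once the scale
  with modular \<open>1\<close> is known to exist and to be unique.
\<close>

lemma varexp_sphere_iff: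
  "f \<in> varexp_sphere \<alpha> \<longleftrightarrow> f \<in> varexp_space \<alpha> \<and> modular \<alpha> f 1 = 1"
proof (cases "f \<in> varexp_space \<alpha> \<and> \<not> (AE x in lebesgue. f x = 0)")
  case True
  then obtain l where l: "0 < l" "modular \<alpha> f l = 1"
    using modular_eq_1_exists by blast
  have "varexp_norm \<alpha> f = (THE l. 0 < l \<and> modular \<alpha> f l = 1)"
    using True by (simp add: varexp_norm_def modular_def)
  also have "\<dots> = l"
    by (rule the_equality) (use l modular_eq_1_unique[of f] True in auto)
  finally show ?thesis
    using True l modular_eq_1_unique[of f l 1] by (auto simp: varexp_sphere_def)
next
  case False
  have "modular \<alpha> f 1 = 0" if "AE x in lebesgue. f x = 0"
  proof -
    have "AE x in lebesgue. \<bar>inverse 1 * f x\<bar> powr \<alpha> x = 0"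
      using that by eventually_elim simp
    then show ?thesis
      unfolding modular_def by (rule integral_eq_zero_AE)
  qed
  then show ?thesis
    using False by (auto simp: varexp_sphere_def varexp_norm_def)
qed

lemma varexp_sphere_nonempty: "varexp_sphere \<alpha> \<noteq> {}"
proof -
  define f :: "real \<Rightarrow> real" where "f = indicator {0..1}"
  have f: "\<bar>f x\<bar> powr \<alpha> x = indicator {0..1} x" for x
    using \<alpha>_range[of x] a_pos by (auto simp: f_def indicator_def)
  have "f \<in> varexp_space \<alpha>"
    unfolding varexp_space_def mem_Collect_eq f ennreal_indicator
    by (auto simp: f_def intro!: borel_measurable_indicator)
  moreover have "modular \<alpha> f 1 = 1"
    by (simp add: modular_def f)
  ultimately show ?thesis
    unfolding ex_in_conv[symmetric] varexp_sphere_iff by blast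
qed

text \<open>
  On the unit sphere \<open>\<bar>f x\<bar> powr \<alpha> x\<close> is a probability density; this is the law of the exponent under it.
  All integrals in the theorem depend on \<open>f\<close> only through this law.
\<close>

definition exponent_law :: "(real \<Rightarrow> real) \<Rightarrow> real measure" where
  "exponent_law f = distr (density lebesgue (\<lambda>x. ennreal (\<bar>f x\<bar> powr \<alpha> x))) borel \<alpha>"

lemma sets_exponent_law [simp]: "sets (exponent_law f) = sets borel"
  by (simp add: exponent_law_def)

lemma integral_exponent_law:
  assumes "f \<in> varexp_space \<alpha>" "g \<in> borel_measurable borel"
  shows "(LINT \<gamma>|exponent_law f. g \<gamma>) = (LINT x|lebesgue. \<bar>f x\<bar> powr \<alpha> x * (g (\<alpha> x) :: real))"
proof -
  note [measurable] = varexp_space_measurable[OF assms(1)] assms(2)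
  show ?thesis
    unfolding exponent_law_def by (simp add: integral_distr integral_density)
qed

lemma prob_space_exponent_law:
  assumes f: "f \<in> varexp_sphere \<alpha>"
  shows "prob_space (exponent_law f)"
proof -
  have f': "f \<in> varexp_space \<alpha>" "modular \<alpha> f 1 = 1"
    using f by (simp_all add: varexp_sphere_iff)
  note [measurable] = varexp_space_measurable[OF f'(1)]
  have "(\<integral>\<^sup>+ x. ennreal (\<bar>f x\<bar> powr \<alpha> x) \<partial>lebesgue) = ennreal 1"
    using nn_integral_eq_integral[OF integrable_modular[OF f'(1), of 1]] f'(2)
    by (simp add: modular_def)
  then have "prob_space (density lebesgue (\<lambda>x. ennreal (\<bar>f x\<bar> powr \<alpha> x)))"
    by (intro prob_spaceI) (simp add: emeasure_density)
  then show ?thesis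
    unfolding exponent_law_def by (rule prob_space.prob_space_distr) measurable
qed

lemma AE_exponent_law:
  assumes "f \<in> varexp_space \<alpha>" "AE x in lebesgue. \<alpha> x \<in> {a..b}"
  shows "AE \<gamma> in exponent_law f. \<gamma> \<in> {a..b}"
proof -
  note [measurable] = varexp_space_measurable[OF assms(1)]
  have "AE x in lebesgue. 0 < ennreal (\<bar>f x\<bar> powr \<alpha> x) \<longrightarrow> \<alpha> x \<in> {a..b}"
    using assms(2) by eventually_elim simp
  then show ?thesis
    unfolding exponent_law_def by (simp add: AE_distr_iff AE_density del: AE_conj_iff)
qed

lemma stable_mixture_multistable_integral:
  assumes f: "f \<in> varexp_sphere \<alpha>" and b: "b \<in> {a<..<2}" "AE x in lebesgue. \<alpha> x \<in> {a..b}"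
    and I: "multistable_integral \<alpha> M I"
  shows "stable_mixture M (I f) (exponent_law f) a b"
proof -
  have f': "f \<in> varexp_space \<alpha>"
    using f by (simp add: varexp_sphere_iff)
  interpret prob_space M
    using I by (simp add: multistable_integral_def)
  interpret law: prob_space "exponent_law f"
    by (rule prob_space_exponent_law[OF f])
  have [measurable]: "I f \<in> borel_measurable M"
    using I f' by (simp add: multistable_integral_def)
  have char: "(CLINT \<omega>|M. exp (\<i> * complex_of_real (\<theta> * I f \<omega>))) =
      complex_of_real (exp (- (LINT x|lebesgue. \<bar>\<theta> * f x\<bar> powr \<alpha> x)))" for \<theta>
  proof -
    have "\<forall>(g :: nat \<Rightarrow> real \<Rightarrow> real) (\<eta> :: nat \<Rightarrow> real). (\<forall>l \<in> {1..1}. g l \<in> varexp_space \<alpha>) \<longrightarrow>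
        (CLINT \<omega>|M. exp (\<i> * complex_of_real (\<Sum>l=1..1. \<eta> l * I (g l) \<omega>))) =
          complex_of_real (exp (- (LINT x|lebesgue. \<bar>\<Sum>l=1..1. \<eta> l * g l x\<bar> powr \<alpha> x)))"
      using I unfolding multistable_integral_def by blast
    from this[rule_format, of "\<lambda>_. f" "\<lambda>_. \<theta>"] f' show ?thesis
      by simp
  qed
  show ?thesis
  proof (intro stable_mixture.intro stable_mixture_axioms.intro)
    fix \<theta> :: real
    have "integrable M (\<lambda>\<omega>. exp (\<i> * complex_of_real (\<theta> * I f \<omega>)))"
      by (rule integrable_const_bound[of _ 1]) auto
    then have "(LINT \<omega>|M. Re (exp (\<i> * complex_of_real (\<theta> * I f \<omega>))))
        = exp (- (LINT x|lebesgue. \<bar>\<theta> * f x\<bar> powr \<alpha> x))"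
      by (subst integral_Re) (simp_all add: char del: of_real_mult)
    moreover have "(LINT x|lebesgue. \<bar>\<theta> * f x\<bar> powr \<alpha> x) = (LINT \<gamma>|exponent_law f. \<bar>\<theta>\<bar> powr \<gamma>)"
      using f' by (subst integral_exponent_law) (auto simp: abs_mult powr_mult mult.commute)
    ultimately show "(LINT \<omega>|M. cos (\<theta> * I f \<omega>)) = exp (- (LINT \<gamma>|exponent_law f. \<bar>\<theta>\<bar> powr \<gamma>))"
      by (simp add: Re_exp)
  qed (use b a_pos AE_exponent_law[OF f' b(2)] in \<open>auto intro: prob_space_axioms law.prob_space_axioms\<close>)
qed

lemma multistable_tail_eq:
  assumes "f \<in> varexp_space \<alpha>" "0 < t"
  shows "multistable_tail \<alpha> f t = (LINT \<gamma>|exponent_law f. t powr - \<gamma> * stable_tail_const \<gamma>)"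
proof -
  have "\<bar>inverse t * f x\<bar> powr \<alpha> x = \<bar>f x\<bar> powr \<alpha> x * t powr - \<alpha> x" for x
    using assms(2) by (simp add: abs_mult powr_mult inverse_powr powr_minus mult.commute)
  then show ?thesis
    using assms by (subst integral_exponent_law) (auto simp: multistable_tail_def mult.assoc)
qed

end

section \<open>Tails of the multistable integral\<close>

theorem theorem1p2:
  fixes a b :: real and \<alpha> :: "real \<Rightarrow> real"
    and M :: "'w measure" and I :: "(real \<Rightarrow> real) \<Rightarrow> 'w \<Rightarrow> real"
  assumes "0 < a"
    and "\<alpha> \<in> borel_measurable lebesgue"
    and "\<And>x. \<alpha> x \<in> {a..2}"
    and "b \<in> {a<..<2}"
    and "AE x in lebesgue. \<alpha> x \<in> {a..b}"
    and "multistable_integral \<alpha> M I"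
  shows "((\<lambda>t. SUP f \<in> varexp_sphere \<alpha>.
            ereal \<bar>measure M {\<omega> \<in> space M. \<bar>I f \<omega>\<bar> > t} / multistable_tail \<alpha> f t - 1\<bar>)
          \<longlongrightarrow> 0) at_top"
proof -
  interpret variable_exponent \<alpha> a
    by unfold_locales (use assms in auto)
  let ?S = "\<lambda>t. SUP f \<in> varexp_sphere \<alpha>.
      ereal \<bar>measure M {\<omega> \<in> space M. \<bar>I f \<omega>\<bar> > t} / multistable_tail \<alpha> f t - 1\<bar>"
  have nonneg: "0 \<le> ?S t" for t
  proof -
    obtain f where "f \<in> varexp_sphere \<alpha>"
      using varexp_sphere_nonempty by blast
    then show ?thesis
      by (rule SUP_upper2) simp
  qed
  show ?thesis
  proof (rule order_tendstoI)
    fix y :: ereal assume "y < 0"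
    then show "eventually (\<lambda>t. y < ?S t) at_top"
      by (intro always_eventually allI less_le_trans[OF _ nonneg])
  next
    fix y :: ereal assume "0 < y"
    then obtain \<eta> where \<eta>: "0 < \<eta>" "ereal \<eta> < y"
      using ereal_dense2[of 0 y] by (auto simp: zero_ereal_def)
    obtain t\<^sub>0 where t0: "\<And>(M :: 'w measure) X \<nu> t. stable_mixture M X \<nu> a b \<Longrightarrow> t\<^sub>0 \<le> t \<Longrightarrow>
        \<bar>measure M {\<omega> \<in> space M. \<bar>X \<omega>\<bar> > t} / (LINT \<gamma>|\<nu>. t powr - \<gamma> * stable_tail_const \<gamma>) - 1\<bar> \<le> \<eta>"
      using stable_mixture_tail_uniform[of a b \<eta>] assms \<eta> by auto
    have "?S t < y" if "max 1 t\<^sub>0 \<le> t" for t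
    proof -
      have "?S t \<le> ereal \<eta>"
      proof (rule SUP_least)
        fix f assume f: "f \<in> varexp_sphere \<alpha>"
        then show "ereal \<bar>measure M {\<omega> \<in> space M. \<bar>I f \<omega>\<bar> > t} / multistable_tail \<alpha> f t - 1\<bar> \<le> ereal \<eta>"
          using t0[OF stable_mixture_multistable_integral[OF f assms(4-6)], of t] that
          by (simp add: multistable_tail_eq varexp_sphere_iff)
      qed
      then show ?thesis
        using \<eta>(2) by (rule le_less_trans)
    qed
    then show "eventually (\<lambda>t. ?S t < y) at_top"
      unfolding eventually_at_top_linorder by blast
  qed
qed

end
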